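(* Let $G$ be a forest (a finite undirected acyclic graph) and $L(G)$ its line graph. Then $h_{\mathcal{P}(\mathcal{B}_G)}(t)=h_{\mathcal{P}^{\square}(\mathcal{B}_{L(G)})}(t)$.
   Context: For a finite undirected graph $H$ with vertex set $V$, the graphical building set $\mathcal{B}_H$ is the set of nonempty $I\subseteq V$ such that the induced subgraph $H|_I$ is connected; it is a building set on $V$. The line graph $L(G)$ has vertex set $E(G)$, two edges being adjacent when they share an endpoint. In general, a building set on a finite set $X$ is a collection $\mathcal{B}$ of nonempty subsets of $X$ containing all singletons and closed under unions of intersecting members; $\mathcal{B}_{\max}$ denotes its inclusion-maximal elements. A nested collection is a subset $N\subseteq\mathcal{B}\setminus\mathcal{B}_{\max}$ whose members are pairwise nested or disjoint and such that no union of $k\ge2$ pairwise disjoint members lies in $\mathcal{B}$. An extended nested collection is a set $\{I_1,\dots,I_m,x_{i_1},\dots,x_{i_r}\}$ with $I_j\in\mathcal{B}$ (maximal elements allowed) and formal symbols $x_i$ ($i\in X$) such that the $I_j$ are pairwise nested or disjoint, no union of $k\ge2$ pairwise disjoint $I_j$'s lies in $\mathcal{B}$, and no $i_\ell$ lies in any $I_j$. The nestohedron $\mathcal{P}(\mathcal{B})$ is a simple polytope of dimension $d=|X|-|\mathcal{B}_{\max}|$ with $f_i$ ($i$-faces) equal to the number of nested collections of cardinality $d-i$; the extended nestohedron $\mathcal{P}^{\square}(\mathcal{B})$ is a simple polytope of dimension $|X|$ with $f_i$ equal to the number of extended nested collections of cardinality $|X|-i$; for $X=\varnothing$ both are a point.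 For a $d$-polytope, $f_P(t)=\sum_{i=0}^d f_it^i$ and $h_P$ is defined by $f_P(t)=h_P(t+1)$. *)

theory Defs
  imports "HOL-Analysis.Analysis" "HOL-Computational_Algebra.Polynomial"
begin

section \<open>Graphs\<close>

definition simple_graph :: "'v set \<Rightarrow> 'v set set \<Rightarrow> bool" where
  "simple_graph V E \<longleftrightarrow> finite V \<and> (\<forall>e\<in>E. e \<subseteq> V \<and> card e = 2)"

definition is_cycle :: "'v set set \<Rightarrow> 'v list \<Rightarrow> bool" where
  "is_cycle E c \<longleftrightarrow> length c \<ge> 3 \<and> distinct c \<and>
     (\<forall>i. Suc i < length c \<longrightarrow> {c ! i, c ! Suc i} \<in> E) \<and> {last c, hd c} \<in> E"

definition forest :: "'v set \<Rightarrow> 'v set set \<Rightarrow> bool" where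
  "forest V E \<longleftrightarrow> simple_graph V E \<and> (\<nexists>c. is_cycle E c)"

definition graph_connected :: "'v set \<Rightarrow> 'v set set \<Rightarrow> bool" where
  "graph_connected V E \<longleftrightarrow> (\<forall>u\<in>V. \<forall>v\<in>V. (u, v) \<in> {(x, y). {x, y} \<in> E}\<^sup>*)"

definition induced_edges :: "'v set set \<Rightarrow> 'v set \<Rightarrow> 'v set set" where
  "induced_edges E I = {e \<in> E. e \<subseteq> I}"

text \<open>The line graph of \<open>(V, E)\<close> is \<open>(E, line_graph_edges E)\<close>.\<close>

definition line_graph_edges :: "'v set set \<Rightarrow> 'v set set set" where
  "line_graph_edges E = {{e, f} |e f. e \<in> E \<and> f \<in> E \<and> e \<noteq> f \<and> e \<inter> f \<noteq> {}}"

lemma simple_graph_line_graph: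
  assumes "simple_graph V E"
  shows "simple_graph E (line_graph_edges E)"
proof -
  have "E \<subseteq> Pow V" "finite V"
    using assms by (auto simp: simple_graph_def)
  then have "finite E"
    by (meson finite_Pow_iff finite_subset)
  then show ?thesis
    by (auto simp: simple_graph_def line_graph_edges_def card_2_iff)
qed


section \<open>Building sets and (extended) nested collections\<close>

definition building_set :: "'x set \<Rightarrow> 'x set set \<Rightarrow> bool" where
  "building_set X B \<longleftrightarrow> finite X \<and> (\<forall>I\<in>B. I \<subseteq> X \<and> I \<noteq> {}) \<and> (\<forall>i\<in>X. {i} \<in> B) \<and>
     (\<forall>I\<in>B. \<forall>J\<in>B. I \<inter> J \<noteq> {} \<longrightarrow> I \<union> J \<in> B)"

definition graphical_building_set :: "'v set \<Rightarrow> 'v set set \<Rightarrow> 'v set set" where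
  "graphical_building_set V E =
     {I. I \<noteq> {} \<and> I \<subseteq> V \<and> graph_connected I (induced_edges E I)}"

lemma building_set_graphical:
  assumes "finite V"
  shows "building_set V (graphical_building_set V E)"
proof -
  have un: "graph_connected (I \<union> J) (induced_edges E (I \<union> J))"
    if I: "graph_connected I (induced_edges E I)"
      and J: "graph_connected J (induced_edges E J)" and w: "w \<in> I" "w \<in> J" for I J w
  proof -
    let ?R = "\<lambda>K. {(x, y). {x, y} \<in> induced_edges E K}"
    have "(?R I)\<^sup>* \<subseteq> (?R (I \<union> J))\<^sup>*" "(?R J)\<^sup>* \<subseteq> (?R (I \<union> J))\<^sup>*"
      by (intro rtrancl_mono; auto simp: induced_edges_def)+
    then have "(u, w) \<in> (?R (I \<union> J))\<^sup>*" "(w, u) \<in> (?R (I \<union> J))\<^sup>*" if "u \<in> I \<union> J" for u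
      using that I J w unfolding graph_connected_def by blast+
    then show ?thesis
      unfolding graph_connected_def by (meson rtrancl_trans)
  qed
  have "I \<union> J \<in> graphical_building_set V E"
    if "I \<in> graphical_building_set V E" "J \<in> graphical_building_set V E" "I \<inter> J \<noteq> {}" for I J
    using that un unfolding graphical_building_set_def by blast
  then show ?thesis
    unfolding building_set_def
    by (auto simp: assms) (auto simp: graphical_building_set_def graph_connected_def)
qed

definition maximal_members :: "'x set set \<Rightarrow> 'x set set" where
  "maximal_members B = {I \<in> B. \<forall>J\<in>B. I \<subseteq> J \<longrightarrow> J = I}"

text \<open>Common to both kinds of collections: members are pairwise nested or disjoint, and no
  union of at least two pairwise disjoint members lies in \<open>B\<close>.\<close>

definition nested_in :: "'x set set \<Rightarrow> 'x set set \<Rightarrow> bool" where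
  "nested_in B N \<longleftrightarrow>
     (\<forall>I\<in>N. \<forall>J\<in>N. I \<subseteq> J \<or> J \<subseteq> I \<or> I \<inter> J = {}) \<and>
     (\<forall>S\<subseteq>N. finite S \<and> card S \<ge> 2 \<and> disjoint S \<longrightarrow> \<Union>S \<notin> B)"

definition nested_collections :: "'x set set \<Rightarrow> 'x set set set" where
  "nested_collections B = {N. N \<subseteq> B - maximal_members B \<and> nested_in B N}"

text \<open>In an extended nested collection, \<open>Inl I\<close> is the member \<open>I \<in> B\<close> and \<open>Inr i\<close> is the
  formal symbol attached to \<open>i \<in> X\<close>.\<close>

definition extended_nested_collections ::
    "'x set \<Rightarrow> 'x set set \<Rightarrow> ('x set + 'x) set set" where
  "extended_nested_collections X B =
     {Inl ` N \<union> Inr ` S |N S. N \<subseteq> B \<and> S \<subseteq> X \<and> nested_in B N \<and> (\<forall>i\<in>S. \<forall>I\<in>N. i \<notin> I)}"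


section \<open>Face numbers of polytopes\<close>

definition h_of_f :: "int poly \<Rightarrow> int poly" where
  "h_of_f f = (THE h. f = pcompose h [:1, 1:])"

lemma h_of_f_unique: "f = pcompose h [:1, 1:] \<longleftrightarrow> h = pcompose f [:- 1, 1:]"
  for f h :: "int poly"
  by (auto simp: pcompose_assoc[symmetric] pcompose_pCons)

lemma h_of_f_eq: "h_of_f f = pcompose f [:- 1, 1:]"
  by (simp add: h_of_f_def h_of_f_unique)

text \<open>The empty face has \<open>aff_dim\<close> equal to \<open>-1\<close> and is not counted.\<close>

definition face_number :: "'a::euclidean_space set \<Rightarrow> nat \<Rightarrow> nat" where
  "face_number P i = card {F. F face_of P \<and> aff_dim F = int i}"

definition f_polynomial :: "'a::euclidean_space set \<Rightarrow> int poly" where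
  "f_polynomial P = (\<Sum>i\<le>nat (aff_dim P). monom (int (face_number P i)) i)"

definition h_polynomial :: "'a::euclidean_space set \<Rightarrow> int poly" where
  "h_polynomial P = h_of_f (f_polynomial P)"

definition simple_polytope :: "'a::euclidean_space set \<Rightarrow> bool" where
  "simple_polytope P \<longleftrightarrow> polytope P \<and>
     (\<forall>v. {v} face_of P \<longrightarrow> int (card {F. F facet_of P \<and> v \<in> F}) = aff_dim P)"

definition face_poset_dual_to :: "'a::euclidean_space set \<Rightarrow> 'b set set \<Rightarrow> bool" where
  "face_poset_dual_to P C \<longleftrightarrow>
     (\<exists>\<phi>. bij_betw \<phi> {F. F face_of P \<and> F \<noteq> {}} C \<and>
          (\<forall>F G. F face_of P \<and> F \<noteq> {} \<and> G face_of P \<and> G \<noteq> {} \<longrightarrow>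
             (F \<subseteq> G \<longleftrightarrow> \<phi> G \<subseteq> \<phi> F)))"


section \<open>Nestohedra and extended nestohedra\<close>

text \<open>These polytopes are determined only up to combinatorial equivalence, by their face posets,
  so they are introduced as predicates on polytopes. Independently of any realization, the
  counting polynomials below are their \<open>f\<close>-polynomials.\<close>

definition nestohedron_dim :: "'x set \<Rightarrow> 'x set set \<Rightarrow> nat" where
  "nestohedron_dim X B = card X - card (maximal_members B)"

definition is_nestohedron :: "'x set \<Rightarrow> 'x set set \<Rightarrow> 'a::euclidean_space set \<Rightarrow> bool" where
  "is_nestohedron X B P \<longleftrightarrow> simple_polytope P \<and> aff_dim P = int (nestohedron_dim X B) \<and>
     face_poset_dual_to P (nested_collections B)"

definition is_extended_nestohedron ::
    "'x set \<Rightarrow> 'x set set \<Rightarrow> 'a::euclidean_space set \<Rightarrow> bool" where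
  "is_extended_nestohedron X B P \<longleftrightarrow> simple_polytope P \<and> aff_dim P = int (card X) \<and>
     face_poset_dual_to P (extended_nested_collections X B)"

definition nestohedron_f :: "'x set \<Rightarrow> 'x set set \<Rightarrow> int poly" where
  "nestohedron_f X B = (let d = nestohedron_dim X B in
     \<Sum>i\<le>d. monom (int (card {N \<in> nested_collections B. card N = d - i})) i)"

definition extended_nestohedron_f :: "'x set \<Rightarrow> 'x set set \<Rightarrow> int poly" where
  "extended_nestohedron_f X B = (let d = card X in
     \<Sum>i\<le>d. monom (int (card {M \<in> extended_nested_collections X B. card M = d - i})) i)"

end

(* For a building set B let a(U) be the sum of t^|N| over the nested families N in B with union U.
   If U lies in B then U lies in every such N, and deleting it gives a(U) = t * sum of a(W) over the
   proper subsets W of U; moreover a(U) is the product of a over the components of U.  Let a_V and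
   a_E be these functions for the forest and for its line graph.  The generating function of the
   extended nested collections of the line graph on an edge set D is
   X(D) = sum over F in D of (1 + t)^|D - F| a_E(F).  The recursion for a_E, together with the fact
   that a tree has one vertex more than edges, shows that the sum over all W in a connected U of
   t^(components of W) X(E[W]) equals (1 + t) X(E[U]).  Hence t^(components of U) X(E[U]) satisfies
   the recursion of a_V, so the two agree, and U = V compares the numbers of nested and of extended
   nested collections of each cardinality.  For polytopes these numbers are the face numbers, since
   the dual complex is closed under subsets. *)

theory Submission
  imports Defs
begin

lemma sum_Pow_binomial:
  fixes s t :: "'r::comm_semiring_1"
  assumes "finite A"
  shows "(\<Sum>S\<in>Pow A. s ^ card S * t ^ card (A - S)) = (s + t) ^ card A"
  using assms
proof (induction A)
  case (insert a A)
  have inj: "inj_on (insert a) (Pow A)"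
    using insert.hyps by (auto simp: inj_on_def)
  have "(\<Sum>S\<in>Pow (insert a A). s ^ card S * t ^ card (insert a A - S))
      = (\<Sum>S\<in>Pow A. s ^ card S * t ^ card (insert a A - S))
        + (\<Sum>S\<in>insert a ` Pow A. s ^ card S * t ^ card (insert a A - S))"
    unfolding Pow_insert using insert.hyps by (subst sum.union_disjoint) auto
  also have "(\<Sum>S\<in>insert a ` Pow A. s ^ card S * t ^ card (insert a A - S))
      = (\<Sum>S\<in>Pow A. s * (s ^ card S * t ^ card (A - S)))"
  proof (subst sum.reindex[OF inj], rule sum.cong)
    fix S assume "S \<in> Pow A"
    then have "finite S" "a \<notin> S" "insert a A - insert a S = A - S"
      using insert.hyps finite_subset by auto
    then show "((\<lambda>S. s ^ card S * t ^ card (insert a A - S)) \<circ> insert a) S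
        = s * (s ^ card S * t ^ card (A - S))"
      by (simp add: mult.assoc)
  qed simp
  also have "(\<Sum>S\<in>Pow A. s ^ card S * t ^ card (insert a A - S))
      = (\<Sum>S\<in>Pow A. t * (s ^ card S * t ^ card (A - S)))"
  proof (rule sum.cong)
    fix S assume "S \<in> Pow A"
    then have "insert a A - S = insert a (A - S)"
      using insert.hyps by auto
    then show "s ^ card S * t ^ card (insert a A - S) = t * (s ^ card S * t ^ card (A - S))"
      using insert.hyps by (simp add: mult_ac)
  qed simp
  finally show ?case
    using insert by (simp flip: sum_distrib_left add: algebra_simps)
qed simp

lemma sum_between:
  assumes "C \<subseteq> U"
  shows "(\<Sum>W | C \<subseteq> W \<and> W \<subseteq> U. g W) = (\<Sum>Q\<in>Pow (U - C). g (C \<union> Q))"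
proof (rule sum.reindex_bij_witness[where i = "\<lambda>Q. C \<union> Q" and j = "\<lambda>W. W - C"])
  fix W assume "W \<in> {W. C \<subseteq> W \<and> W \<subseteq> U}"
  then have "C \<union> (W - C) = W"
    by blast
  then show "C \<union> (W - C) = W" "g (C \<union> (W - C)) = g W"
    by simp_all
qed (use assms in blast)+


section \<open>Nested families with prescribed union\<close>

definition nested_covers :: "'x set set \<Rightarrow> 'x set \<Rightarrow> 'x set set set" where
  "nested_covers B U = {N. N \<subseteq> B \<and> nested_in B N \<and> \<Union>N = U}"

definition cover_gf :: "'r::comm_ring_1 \<Rightarrow> 'x set set \<Rightarrow> 'x set \<Rightarrow> 'r" where
  "cover_gf t B U = (\<Sum>N\<in>nested_covers B U. t ^ card N)"

definition subset_gf :: "'r::comm_ring_1 \<Rightarrow> 'r \<Rightarrow> 'x set set \<Rightarrow> 'x set \<Rightarrow> 'r" where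
  "subset_gf s t B U = (\<Sum>W\<in>Pow U. s ^ card (U - W) * cover_gf t B W)"

lemma nested_covers_subset_Pow: "nested_covers B U \<subseteq> Pow (Pow U)"
  by (auto simp: nested_covers_def)

lemma finite_nested_covers: "finite U \<Longrightarrow> finite (nested_covers B U)"
  using nested_covers_subset_Pow finite_subset by (metis finite_Pow_iff)

lemma finite_nested_cover: "finite U \<Longrightarrow> N \<in> nested_covers B U \<Longrightarrow> finite N"
  using nested_covers_subset_Pow[of B U] finite_subset by (metis PowD finite_Pow_iff in_mono)

lemma nested_in_mono: "nested_in B N \<Longrightarrow> M \<subseteq> N \<Longrightarrow> nested_in B M"
  unfolding nested_in_def by (meson subset_trans subsetD)

lemma building_set_finite: "building_set X B \<Longrightarrow> finite X"
  by (simp add: building_set_def)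

lemma building_set_subset: "building_set X B \<Longrightarrow> I \<in> B \<Longrightarrow> I \<subseteq> X"
  by (simp add: building_set_def)

lemma building_set_nonempty: "building_set X B \<Longrightarrow> I \<in> B \<Longrightarrow> I \<noteq> {}"
  by (auto simp: building_set_def)

lemma building_set_singleton: "building_set X B \<Longrightarrow> i \<in> X \<Longrightarrow> {i} \<in> B"
  by (auto simp: building_set_def)

lemma building_set_Un:
  "building_set X B \<Longrightarrow> I \<in> B \<Longrightarrow> J \<in> B \<Longrightarrow> I \<inter> J \<noteq> {} \<Longrightarrow> I \<union> J \<in> B"
  unfolding building_set_def by blast

lemma building_set_finite_members: "building_set X B \<Longrightarrow> finite B"
  using building_set_subset building_set_finite by (metis PowI finite_Pow_iff finite_subset subsetI)

lemma nested_covers_empty: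
  assumes "building_set X B"
  shows "nested_covers B {} = {{}}"
proof -
  have "N = {}" if "N \<subseteq> B" "\<Union>N = {}" for N
    using that building_set_nonempty[OF assms] by blast
  moreover have "{} \<in> nested_covers B {}"
    by (auto simp: nested_covers_def nested_in_def)
  ultimately show ?thesis
    unfolding nested_covers_def by blast
qed

lemma cover_gf_empty: "building_set X B \<Longrightarrow> cover_gf t B {} = 1"
  by (simp add: cover_gf_def nested_covers_empty)

text \<open>The maximal members of a nested family are pairwise disjoint, so there is only one of them
  if the union of the family lies in \<open>B\<close>.\<close>

lemma mem_nested_cover:
  assumes "building_set X B" "U \<in> B" "N \<in> nested_covers B U"
  shows "U \<in> N"
proof -
  have N: "N \<subseteq> B" "nested_in B N" "\<Union>N = U"
    using assms(3) by (auto simp: nested_covers_def)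
  have fin: "finite N"
    using N(1) building_set_finite_members[OF assms(1)] finite_subset by blast
  define S where "S = {I \<in> N. \<forall>J\<in>N. I \<subseteq> J \<longrightarrow> J = I}"
  have S: "S \<subseteq> N" "finite S"
    using fin by (auto simp: S_def)
  have "disjoint S"
    unfolding disjoint_def
  proof (intro ballI impI)
    fix I J assume *: "I \<in> S" "J \<in> S" "I \<noteq> J"
    then have "I \<subseteq> J \<or> J \<subseteq> I \<or> I \<inter> J = {}"
      using N(2) S(1) by (auto simp: nested_in_def)
    then show "I \<inter> J = {}"
      using * by (auto simp: S_def)
  qed
  have "\<Union>S = U"
  proof
    show "U \<subseteq> \<Union>S"
    proof
      fix u assume "u \<in> U"
      then obtain I where "I \<in> N" "u \<in> I"
        using N(3) by auto
      obtain J where "J \<in> N" "I \<subseteq> J" "\<forall>K\<in>N. J \<subseteq> K \<longrightarrow> J = K"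
        using finite_has_maximal2[OF fin \<open>I \<in> N\<close>] by blast
      then show "u \<in> \<Union>S"
        using \<open>u \<in> I\<close> by (auto simp: S_def)
    qed
  qed (use S(1) N(3) in auto)
  then have "\<not> card S \<ge> 2"
    using N(2) S \<open>disjoint S\<close> assms(2) by (auto simp: nested_in_def)
  moreover have "S \<noteq> {}"
    using \<open>\<Union>S = U\<close> building_set_nonempty[OF assms(1,2)] by auto
  then have "card S \<noteq> 0"
    using S(2) by simp
  ultimately have "card S = 1"
    by linarith
  then obtain I where "S = {I}"
    by (auto simp: card_1_singleton_iff)
  then show ?thesis
    using \<open>\<Union>S = U\<close> S(1) by auto
qed

lemma insert_nested_covers:
  assumes "building_set X B" "U \<in> B" "W \<subset> U" "N \<in> nested_covers B W"
  shows "insert U N \<in> nested_covers B U"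
proof -
  have N: "N \<subseteq> B" "nested_in B N" "\<Union>N = W"
    using assms(4) by (auto simp: nested_covers_def)
  have sub: "I \<subseteq> U" if "I \<in> N" for I
    using N(3) assms(3) that by auto
  have "\<Union>S \<notin> B" if S: "S \<subseteq> insert U N" "finite S" "card S \<ge> 2" "disjoint S" for S
  proof (cases "U \<in> S")
    case True
    moreover have "\<not> S \<subseteq> {U}"
      using S(3) card_mono[of "{U}" S] by auto
    ultimately obtain I where "I \<in> S" "I \<noteq> U" "I \<in> N"
      using S(1) by auto
    then have "I \<inter> U = {}"
      using S(4) True by (auto simp: disjoint_def)
    then have False
      using sub \<open>I \<in> N\<close> N(1) building_set_nonempty[OF assms(1)] by blast
    then show ?thesis ..
  next
    case False
    then show ?thesis
      using S N(2) by (auto simp: nested_in_def subset_insert)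
  qed
  moreover have "I \<subseteq> J \<or> J \<subseteq> I \<or> I \<inter> J = {}" if "I \<in> insert U N" "J \<in> insert U N" for I J
    using that N(2) sub unfolding nested_in_def by (metis insertE subset_refl)
  ultimately have "nested_in B (insert U N)"
    unfolding nested_in_def by blast
  then show ?thesis
    using N assms(2,3) by (auto simp: nested_covers_def)
qed

lemma cover_gf_connected:
  assumes "building_set X B" "U \<in> B"
  shows "cover_gf t B U = t * (\<Sum>W\<in>Pow U - {U}. cover_gf t B W)"
proof -
  have finU: "finite U"
    using building_set_subset[OF assms] building_set_finite[OF assms(1)] by (rule finite_subset)
  define \<A> where "\<A> = (\<Union>W\<in>Pow U - {U}. nested_covers B W)"
  have notin: "U \<notin> N" if "N \<in> \<A>" for N
    using that by (auto simp: \<A>_def nested_covers_def)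
  have fin: "finite N" if N: "N \<in> \<A>" for N
  proof -
    obtain W where "W \<subseteq> U" "N \<in> nested_covers B W"
      using N by (auto simp: \<A>_def)
    then show ?thesis
      using finite_nested_cover[OF finite_subset[OF _ finU]] by blast
  qed
  have "bij_betw (insert U) \<A> (nested_covers B U)"
    unfolding bij_betw_def
  proof
    show "inj_on (insert U) \<A>"
      using notin by (auto simp: inj_on_def insert_ident)
    show "insert U ` \<A> = nested_covers B U"
    proof
      show "insert U ` \<A> \<subseteq> nested_covers B U"
        using insert_nested_covers[OF assms] by (auto simp: \<A>_def)
      show "nested_covers B U \<subseteq> insert U ` \<A>"
      proof
        fix N assume N: "N \<in> nested_covers B U"
        then have "U \<in> N"
          using mem_nested_cover assms by metis
        have 1: "N - {U} \<in> nested_covers B (\<Union>(N - {U}))"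
          using N nested_in_mono[of B N "N - {U}"] by (auto simp: nested_covers_def)
        moreover have "\<Union>(N - {U}) \<noteq> U"
          using 1 mem_nested_cover[OF assms, of "N - {U}"] by auto
        moreover have "\<Union>(N - {U}) \<subseteq> U"
          using N by (auto simp: nested_covers_def)
        ultimately have "N - {U} \<in> \<A>"
          unfolding \<A>_def by blast
        then show "N \<in> insert U ` \<A>"
          using \<open>U \<in> N\<close> by (metis image_iff insert_Diff)
      qed
    qed
  qed
  then have "cover_gf t B U = (\<Sum>N\<in>\<A>. t ^ card (insert U N))"
    unfolding cover_gf_def by (rule sum.reindex_bij_betw[symmetric])
  also have "\<dots> = (\<Sum>N\<in>\<A>. t * t ^ card N)"
    using fin notin by (intro sum.cong) auto
  also have "\<dots> = t * (\<Sum>N\<in>\<A>. t ^ card N)"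
    by (simp add: sum_distrib_left)
  also have "(\<Sum>N\<in>\<A>. t ^ card N) = (\<Sum>W\<in>Pow U - {U}. cover_gf t B W)"
    unfolding \<A>_def cover_gf_def
    by (rule sum.UNION_disjoint)
      (use finite_nested_covers[OF finite_subset[OF _ finU]] finU in
        \<open>auto simp: nested_covers_def\<close>)
  finally show ?thesis .
qed

definition separated :: "'x set set \<Rightarrow> 'x set \<Rightarrow> 'x set \<Rightarrow> bool" where
  "separated B U W \<longleftrightarrow> U \<inter> W = {} \<and> (\<forall>J\<in>B. J \<subseteq> U \<union> W \<longrightarrow> J \<subseteq> U \<or> J \<subseteq> W)"

lemma separated_mono:
  assumes "separated B U W" "U' \<subseteq> U" "W' \<subseteq> W"
  shows "separated B U' W'"
proof -
  have dis: "U \<inter> W = {}"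
    using assms(1) by (simp add: separated_def)
  have "J \<subseteq> U' \<or> J \<subseteq> W'" if "J \<in> B" "J \<subseteq> U' \<union> W'" for J
  proof -
    have "J \<subseteq> U \<or> J \<subseteq> W"
      using that assms unfolding separated_def by (meson Un_mono subset_trans)
    then show ?thesis
      using that(2) assms(2,3) dis by blast
  qed
  then show ?thesis
    using assms(2,3) dis by (auto simp: separated_def)
qed

lemma obtain_separated:
  assumes "building_set X B" "U \<subseteq> X" "U \<noteq> {}" "U \<notin> B"
  obtains U1 U2 where "U = U1 \<union> U2" "U1 \<noteq> {}" "U2 \<noteq> {}" "separated B U1 U2"
proof -
  have fin: "finite {I \<in> B. I \<subseteq> U}"
    using building_set_finite_members[OF assms(1)] by simp
  obtain u where "u \<in> U"
    using assms(3) by auto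
  then have "{u} \<in> {I \<in> B. I \<subseteq> U}"
    using building_set_singleton[OF assms(1)] assms(2) by auto
  then obtain I where I: "I \<in> B" "I \<subseteq> U"
    and max: "\<And>J. J \<in> B \<Longrightarrow> J \<subseteq> U \<Longrightarrow> I \<subseteq> J \<Longrightarrow> J = I"
    using finite_has_maximal2[OF fin] by (smt (verit) mem_Collect_eq)
  have "J \<subseteq> I \<or> J \<inter> I = {}" if "J \<in> B" "J \<subseteq> U" for J
    using building_set_Un[OF assms(1), of I J] max[of "I \<union> J"] that I by auto
  then have "separated B I (U - I)"
    using I(2) unfolding separated_def by blast
  then show ?thesis
    using that[of I "U - I"] I building_set_nonempty[OF assms(1)] assms(4) by auto
qed

lemma nested_covers_Un:
  assumes "building_set X B" "separated B U W" "N \<in> nested_covers B U" "M \<in> nested_covers B W"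
  shows "N \<union> M \<in> nested_covers B (U \<union> W)"
proof -
  have N: "N \<subseteq> B" "nested_in B N" "\<Union>N = U" and M: "M \<subseteq> B" "nested_in B M" "\<Union>M = W"
    using assms(3,4) by (auto simp: nested_covers_def)
  have dis: "U \<inter> W = {}"
    using assms(2) by (auto simp: separated_def)
  have inN: "I \<in> N" if "I \<in> N \<union> M" "I \<subseteq> U" for I
    using that dis M(1,3) building_set_nonempty[OF assms(1)] by blast
  have inM: "I \<in> M" if "I \<in> N \<union> M" "I \<subseteq> W" for I
    using that dis N(1,3) building_set_nonempty[OF assms(1)] by blast
  have "\<Union>S \<notin> B" if S: "S \<subseteq> N \<union> M" "finite S" "card S \<ge> 2" "disjoint S" for S
  proof
    assume "\<Union>S \<in> B"
    moreover have "\<Union>S \<subseteq> U \<union> W"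
      using S(1) N(3) M(3) by blast
    ultimately consider "\<Union>S \<subseteq> U" | "\<Union>S \<subseteq> W"
      using assms(2) by (auto simp: separated_def)
    then have "S \<subseteq> N \<or> S \<subseteq> M"
      by cases (use S(1) inN inM in blast)+
    then show False
      using N(2) M(2) S(2-4) \<open>\<Union>S \<in> B\<close> by (auto simp: nested_in_def)
  qed
  moreover have "I \<subseteq> J \<or> J \<subseteq> I \<or> I \<inter> J = {}" if "I \<in> N \<union> M" "J \<in> N \<union> M" for I J
  proof -
    have "I \<inter> J = {}" if "I \<in> N" "J \<in> M" for I J
      using that N(3) M(3) dis by blast
    then show ?thesis
      using that N(2) M(2) unfolding nested_in_def by (metis Int_commute Un_iff)
  qed
  ultimately have "nested_in B (N \<union> M)"
    unfolding nested_in_def by blast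
  then show ?thesis
    using N M by (auto simp: nested_covers_def)
qed

lemma cover_gf_Un:
  assumes "building_set X B" "finite U" "finite W" "separated B U W"
  shows "cover_gf t B (U \<union> W) = cover_gf t B U * cover_gf t B W"
proof -
  let ?C = "nested_covers B"
  have dis: "U \<inter> W = {}"
    using assms(4) by (auto simp: separated_def)
  have restr: "N \<inter> Pow U \<in> ?C U" "N \<inter> Pow W \<in> ?C W" "N \<inter> Pow U \<union> N \<inter> Pow W = N"
    if "N \<in> ?C (U \<union> W)" for N
  proof -
    have N: "N \<subseteq> B" "nested_in B N" "\<Union>N = U \<union> W"
      using that by (auto simp: nested_covers_def)
    then have sub: "I \<subseteq> U \<or> I \<subseteq> W" if "I \<in> N" for I
      using that assms(4) unfolding separated_def by blast
    then show "N \<inter> Pow U \<union> N \<inter> Pow W = N"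
      by auto
    have "U \<subseteq> \<Union>(N \<inter> Pow U)" "W \<subseteq> \<Union>(N \<inter> Pow W)"
    proof -
      have "u \<in> \<Union>(N \<inter> Pow U) \<and> u \<in> U \<or> u \<in> \<Union>(N \<inter> Pow W) \<and> u \<in> W"
        if u: "u \<in> U \<union> W" for u
      proof -
        obtain I where "I \<in> N" "u \<in> I"
          using u N(3) by auto
        then show ?thesis
          using sub[of I] by auto
      qed
      then show "U \<subseteq> \<Union>(N \<inter> Pow U)" "W \<subseteq> \<Union>(N \<inter> Pow W)"
        using dis by blast+
    qed
    then have "\<Union>(N \<inter> Pow U) = U" "\<Union>(N \<inter> Pow W) = W"
      by auto
    then show "N \<inter> Pow U \<in> ?C U" "N \<inter> Pow W \<in> ?C W"
      using N(1,2) nested_in_mono[of B N] by (auto simp: nested_covers_def)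
  qed
  have un: "N \<union> M \<in> ?C (U \<union> W)" "(N \<union> M) \<inter> Pow U = N" "(N \<union> M) \<inter> Pow W = M"
    "card (N \<union> M) = card N + card M" if "N \<in> ?C U" "M \<in> ?C W" for N M
  proof -
    show "N \<union> M \<in> ?C (U \<union> W)"
      using nested_covers_Un[OF assms(1,4) that] .
    have sub: "N \<subseteq> Pow U" "M \<subseteq> Pow W" and ne: "{} \<notin> N" "{} \<notin> M"
      using that building_set_nonempty[OF assms(1)] by (auto simp: nested_covers_def)
    have "M \<inter> Pow U = {}" "N \<inter> Pow W = {}"
    proof -
      have disj: "\<not> (I \<subseteq> U \<and> I \<subseteq> W)" if "I \<noteq> {}" for I
        using that dis by blast
      have "I \<notin> Pow U" if "I \<in> M" for I
        using disj[of I] that sub(2) ne(2) by (metis PowD subsetD)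
      moreover have "I \<notin> Pow W" if "I \<in> N" for I
        using disj[of I] that sub(1) ne(1) by (metis PowD subsetD)
      ultimately show "M \<inter> Pow U = {}" "N \<inter> Pow W = {}"
        by blast+
    qed
    moreover from this have "N \<inter> M = {}"
      using sub by auto
    ultimately show "(N \<union> M) \<inter> Pow U = N" "(N \<union> M) \<inter> Pow W = M"
      using sub by (auto simp: Int_Un_distrib2)
    show "card (N \<union> M) = card N + card M"
      using finite_nested_cover[OF assms(2) that(1)] finite_nested_cover[OF assms(3) that(2)]
        \<open>N \<inter> M = {}\<close> by (rule card_Un_disjoint)
  qed
  have card_restr: "card (N \<inter> Pow U) + card (N \<inter> Pow W) = card N" if "N \<in> ?C (U \<union> W)" for N
    using un(4)[OF restr(1,2)[OF that]] restr(3)[OF that] by simp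
  have "cover_gf t B (U \<union> W) = (\<Sum>(N, M)\<in>?C U \<times> ?C W. t ^ card N * t ^ card M)"
    unfolding cover_gf_def
    by (rule sum.reindex_bij_witness[where i = "\<lambda>(N, M). N \<union> M"
          and j = "\<lambda>N. (N \<inter> Pow U, N \<inter> Pow W)"])
      (use restr un card_restr in \<open>simp_all add: split_beta mem_Times_iff flip: power_add\<close>)
  then show ?thesis
    by (simp add: cover_gf_def sum_product sum.cartesian_product)
qed

lemma subset_gf_Un:
  assumes "building_set X B" "finite U" "finite W" "separated B U W"
  shows "subset_gf s t B (U \<union> W) = subset_gf s t B U * subset_gf s t B W"
proof -
  have dis: "U \<inter> W = {}"
    using assms(4) by (auto simp: separated_def)
  have gf: "s ^ card (U \<union> W - (Y \<union> Z)) * cover_gf t B (Y \<union> Z)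
      = (s ^ card (U - Y) * cover_gf t B Y) * (s ^ card (W - Z) * cover_gf t B Z)"
    if "Y \<subseteq> U" "Z \<subseteq> W" for Y Z
  proof -
    have "U \<union> W - (Y \<union> Z) = (U - Y) \<union> (W - Z)"
      using that dis by blast
    moreover have "card ((U - Y) \<union> (W - Z)) = card (U - Y) + card (W - Z)"
      using assms(2,3) dis by (intro card_Un_disjoint) auto
    moreover have "cover_gf t B (Y \<union> Z) = cover_gf t B Y * cover_gf t B Z"
      using that assms separated_mono[of B U W Y Z]
      by (intro cover_gf_Un[OF assms(1)]) (auto intro: finite_subset)
    ultimately show ?thesis
      by (simp add: power_add mult_ac)
  qed
  have "subset_gf s t B (U \<union> W) = (\<Sum>(Y, Z)\<in>Pow U \<times> Pow W.
      s ^ card (U \<union> W - (Y \<union> Z)) * cover_gf t B (Y \<union> Z))"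
    unfolding subset_gf_def
    by (intro sum.reindex_bij_witness[where i = "\<lambda>(Y, Z). Y \<union> Z"
          and j = "\<lambda>Y. (Y \<inter> U, Y \<inter> W)"])
      (use dis in \<open>auto simp flip: Int_Un_distrib simp: Int_absorb2 Int_Un_distrib2\<close>)
  also have "\<dots> = (\<Sum>(Y, Z)\<in>Pow U \<times> Pow W.
      (s ^ card (U - Y) * cover_gf t B Y) * (s ^ card (W - Z) * cover_gf t B Z))"
    using gf by (intro sum.cong) auto
  finally show ?thesis
    by (simp add: subset_gf_def sum_product sum.cartesian_product)
qed

lemma sum_subset_gf:
  assumes "finite U"
  shows "(\<Sum>W\<in>Pow U. t ^ card (U - W) * subset_gf s x B W) = subset_gf (s + t) x B U"
proof -
  let ?b = "cover_gf x B"
  have "(\<Sum>W\<in>Pow U. t ^ card (U - W) * subset_gf s x B W)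
      = (\<Sum>W\<in>Pow U. \<Sum>Y\<in>{Y \<in> Pow U. Y \<subseteq> W}. t ^ card (U - W) * (s ^ card (W - Y) * ?b Y))"
    unfolding subset_gf_def sum_distrib_left by (intro sum.cong) auto
  also have "\<dots> = (\<Sum>Y\<in>Pow U. \<Sum>W | W \<in> Pow U \<and> Y \<subseteq> W.
      t ^ card (U - W) * (s ^ card (W - Y) * ?b Y))"
    using assms by (intro sum.swap_restrict) auto
  also have "\<dots> = (\<Sum>Y\<in>Pow U. (s + t) ^ card (U - Y) * ?b Y)"
  proof (rule sum.cong)
    fix Y assume Y: "Y \<in> Pow U"
    have "(\<Sum>W | W \<in> Pow U \<and> Y \<subseteq> W. t ^ card (U - W) * (s ^ card (W - Y) * ?b Y))
        = (\<Sum>W | Y \<subseteq> W \<and> W \<subseteq> U. t ^ card (U - W) * (s ^ card (W - Y) * ?b Y))"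
      by (intro sum.cong) auto
    also have "\<dots> = (\<Sum>Q\<in>Pow (U - Y). t ^ card (U - (Y \<union> Q)) * (s ^ card (Y \<union> Q - Y) * ?b Y))"
      using Y by (intro sum_between) auto
    also have "\<dots> = (\<Sum>Q\<in>Pow (U - Y). (s ^ card Q * t ^ card (U - Y - Q)) * ?b Y)"
    proof (rule sum.cong)
      fix Q assume "Q \<in> Pow (U - Y)"
      then have "Y \<union> Q - Y = Q" "U - (Y \<union> Q) = U - Y - Q"
        by auto
      then show "t ^ card (U - (Y \<union> Q)) * (s ^ card (Y \<union> Q - Y) * ?b Y)
          = (s ^ card Q * t ^ card (U - Y - Q)) * ?b Y"
        by (simp add: mult_ac)
    qed simp
    also have "\<dots> = (s + t) ^ card (U - Y) * ?b Y"
      using assms by (simp flip: sum_distrib_right add: sum_Pow_binomial)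
    finally show "(\<Sum>W | W \<in> Pow U \<and> Y \<subseteq> W. t ^ card (U - W) * (s ^ card (W - Y) * ?b Y))
        = (s + t) ^ card (U - Y) * ?b Y" .
  qed simp
  finally show ?thesis
    by (simp add: subset_gf_def)
qed

section \<open>Edge counts in forests\<close>

lemma graphical_crossing_edge:
  assumes U: "U \<in> graphical_building_set V E" and A: "A \<subseteq> U" "A \<noteq> {}" "A \<noteq> U"
  obtains a b where "a \<in> A" "b \<in> U - A" "{a, b} \<in> E"
proof -
  let ?R = "{(x, y). {x, y} \<in> induced_edges E U}"
  obtain x y where xy: "x \<in> A" "y \<in> U - A"
    using A by blast
  then have "(x, y) \<in> ?R\<^sup>*"
    using U A(1) by (auto simp: graphical_building_set_def graph_connected_def)
  moreover have "z \<in> A \<or> (\<exists>a\<in>A. \<exists>b\<in>U - A. {a, b} \<in> E)" if "(x, z) \<in> ?R\<^sup>*" for z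
    using that
  proof (induction rule: rtrancl_induct)
    case (step y z)
    then have "{y, z} \<in> E" "z \<in> U"
      by (auto simp: induced_edges_def)
    then show ?case
      using step.IH by blast
  qed (use xy in simp)
  ultimately show ?thesis
    using that xy(2) by blast
qed

lemma edge_in_graphical_building_set:
  assumes "{a, b} \<in> E" "a \<in> V" "b \<in> V"
  shows "{a, b} \<in> graphical_building_set V E"
proof -
  let ?R = "{(x, y). {x, y} \<in> induced_edges E {a, b}}"
  have "{a, b} \<in> induced_edges E {a, b}"
    using assms(1) by (simp add: induced_edges_def)
  then have "(a, b) \<in> ?R" "(b, a) \<in> ?R"
    by (simp_all add: insert_commute)
  then have "(a, b) \<in> ?R\<^sup>*" "(b, a) \<in> ?R\<^sup>*"
    by blast+
  then have "graph_connected {a, b} (induced_edges E {a, b})"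
    unfolding graph_connected_def by simp
  then show ?thesis
    using assms(2,3) by (simp add: graphical_building_set_def)
qed

lemma simple_graph_finite_edges: "simple_graph V E \<Longrightarrow> finite E"
  unfolding simple_graph_def by (metis PowI finite_Pow_iff finite_subset subsetI)

lemma obtain_low_degree_vertex:
  assumes "simple_graph V E" "\<nexists>c. is_cycle E c" "V \<noteq> {}"
  obtains v where "v \<in> V" "card {e \<in> E. v \<in> e} \<le> 1"
proof -
  define path where "path p \<longleftrightarrow> p \<noteq> [] \<and> distinct p \<and> set p \<subseteq> V \<and>
    (\<forall>i. Suc i < length p \<longrightarrow> {p ! i, p ! Suc i} \<in> E)" for p
  have V: "finite V" and E: "\<And>e. e \<in> E \<Longrightarrow> e \<subseteq> V \<and> card e = 2"
    using assms(1) by (auto simp: simple_graph_def)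
  obtain u where "u \<in> V"
    using assms(3) by auto
  then have "path [u]"
    by (simp add: path_def)
  moreover have "\<forall>p. path p \<longrightarrow> length p < Suc (card V)"
    using card_mono[OF V] by (auto simp: path_def less_Suc_eq_le simp flip: distinct_card)
  ultimately obtain p where p: "path p" and max: "\<And>q. path q \<Longrightarrow> length q \<le> length p"
    using ex_has_greatest_nat[of path "[u]" length "Suc (card V)"] by blast
  define v where "v = p ! 0"
  have p': "p \<noteq> []" "distinct p" "set p \<subseteq> V"
    "\<And>i. Suc i < length p \<Longrightarrow> {p ! i, p ! Suc i} \<in> E"
    using p by (auto simp: path_def)
  have edge: "e = {v, p ! 1}" if e: "e \<in> E" "v \<in> e" for e
  proof -
    obtain w where w: "e = {v, w}" "w \<noteq> v"
      using E[OF e(1)] e(2) by (auto simp: card_2_iff)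
    have "w \<in> set p"
    proof (rule ccontr)
      assume "w \<notin> set p"
      moreover have "{(w # p) ! i, (w # p) ! Suc i} \<in> E" if "Suc i < length (w # p)" for i
        using that e(1) w(1) p'(4) by (cases i) (auto simp: v_def insert_commute)
      ultimately have "path (w # p)"
        using p'(2,3) E[OF e(1)] w(1) by (auto simp: path_def)
      then show False
        using max[of "w # p"] by simp
    qed
    then obtain j where j: "j < length p" "p ! j = w"
      by (auto simp: in_set_conv_nth)
    have "j \<noteq> 0"
      using w(2) j(2) unfolding v_def by metis
    moreover have "\<not> j \<ge> 2"
    proof
      assume "j \<ge> 2"
      let ?c = "take (Suc j) p"
      have "last ?c = w"
        using j by (simp add: take_Suc_conv_app_nth)
      moreover have "hd ?c = v"
        using p'(1) by (simp add: v_def hd_conv_nth)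
      ultimately have "{last ?c, hd ?c} \<in> E"
        using e(1) w(1) by (simp add: insert_commute)
      then have "is_cycle E ?c"
        using \<open>j \<ge> 2\<close> j(1) p'(2,4) by (auto simp: is_cycle_def)
      then show False
        using assms(2) by blast
    qed
    ultimately have "j = 1"
      by simp
    then show ?thesis
      using w(1) j(2) by simp
  qed
  have "{e \<in> E. v \<in> e} \<subseteq> {{v, p ! 1}}"
    using edge by auto
  then have "card {e \<in> E. v \<in> e} \<le> 1"
    using card_mono[of "{{v, p ! 1}}"] by simp
  moreover have "v \<in> V"
    using p'(1,3) by (auto simp: v_def)
  ultimately show ?thesis
    using that by blast
qed

lemma acyclic_card_edges_less:
  assumes "simple_graph V E" "\<nexists>c. is_cycle E c" "V \<noteq> {}"
  shows "card E < card V"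
  using assms
proof (induction "card V" arbitrary: V E rule: less_induct)
  case less
  have V: "finite V" and E: "\<And>e. e \<in> E \<Longrightarrow> e \<subseteq> V \<and> card e = 2"
    using less.prems(1) by (auto simp: simple_graph_def)
  obtain v where v: "v \<in> V" "card {e \<in> E. v \<in> e} \<le> 1"
    using obtain_low_degree_vertex less.prems by metis
  show ?case
  proof (cases "V = {v}")
    case True
    have "card e \<le> 1" if "e \<in> E" for e
      using E[OF that] True card_mono[of "{v}" e] by simp
    then have "E = {}"
      using E by fastforce
    then show ?thesis
      using True by simp
  next
    case False
    let ?E' = "{e \<in> E. v \<notin> e}"
    have "simple_graph (V - {v}) ?E'"
      using V E by (auto simp: simple_graph_def)
    moreover have "\<nexists>c. is_cycle ?E' c"
      using less.prems(2) by (auto simp: is_cycle_def)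
    moreover have "card (V - {v}) < card V"
      using V v(1) by (rule card_Diff1_less)
    moreover have "V - {v} \<noteq> {}"
      using False v(1) by auto
    ultimately have "card ?E' < card (V - {v})"
      using less.hyps by blast
    moreover have "card E = card ?E' + card {e \<in> E. v \<in> e}"
      using simple_graph_finite_edges[OF less.prems(1)]
      by (subst card_Un_disjoint[symmetric]) (auto intro!: arg_cong[where f = card])
    moreover have "card (V - {v}) = card V - 1"
      using v(1) by simp
    ultimately show ?thesis
      using v(2) by linarith
  qed
qed

lemma card_graphical_le:
  assumes "finite E" "finite V" "U \<in> graphical_building_set V E"
  shows "card U \<le> card (induced_edges E U) + 1"
proof -
  define \<W> where "\<W> = {W. W \<subseteq> U \<and> W \<noteq> {} \<and> card W \<le> card (induced_edges E W) + 1}"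
  have "U \<subseteq> V" "U \<noteq> {}"
    using assms(3) by (auto simp: graphical_building_set_def)
  then have finU: "finite U"
    using assms(2) finite_subset by blast
  then have "finite \<W>"
    by (simp add: \<W>_def)
  moreover obtain u where "u \<in> U"
    using \<open>U \<noteq> {}\<close> by auto
  then have "{u} \<in> \<W>"
    by (simp add: \<W>_def)
  ultimately obtain W where "W \<in> \<W>" and max: "\<forall>W'\<in>\<W>. W \<subseteq> W' \<longrightarrow> W = W'"
    using finite_has_maximal2 by blast
  then have W: "W \<subseteq> U" "W \<noteq> {}" "card W \<le> card (induced_edges E W) + 1"
    by (simp_all add: \<W>_def)
  have "W = U"
  proof (rule ccontr)
    assume "W \<noteq> U"
    then obtain a b where ab: "a \<in> W" "b \<in> U - W" "{a, b} \<in> E"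
      using graphical_crossing_edge[OF assms(3), of W] W by blast
    have fin: "finite (induced_edges E A)" for A
      using assms(1) by (simp add: induced_edges_def)
    have "card (insert {a, b} (induced_edges E W)) \<le> card (induced_edges E (insert b W))"
      using ab by (intro card_mono fin) (auto simp: induced_edges_def)
    moreover have "{a, b} \<notin> induced_edges E W"
      using ab(2) by (auto simp: induced_edges_def)
    ultimately have "card (induced_edges E W) + 1 \<le> card (induced_edges E (insert b W))"
      using fin by simp
    moreover have "card (insert b W) = card W + 1"
      using ab(2) W finite_subset[OF _ finU] by simp
    ultimately have "insert b W \<in> \<W>"
      using W ab(2) \<open>U \<subseteq> V\<close> by (auto simp: \<W>_def)
    then show False
      using max ab(2) by blast
  qed
  then show ?thesis
    using W by simp
qed

lemma line_graph_edgeD: "{e, f} \<in> line_graph_edges E \<Longrightarrow> e \<noteq> f \<and> e \<inter> f \<noteq> {}"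
  by (auto simp: line_graph_edges_def doubleton_eq_iff)

lemma card_line_graphical_le:
  assumes "simple_graph V E" "F \<in> graphical_building_set E (line_graph_edges E)"
  shows "card (\<Union>F) \<le> card F + 1"
proof -
  define \<W> where "\<W> = {W. W \<subseteq> F \<and> W \<noteq> {} \<and> card (\<Union>W) \<le> card W + 1}"
  have F: "F \<subseteq> E" "F \<noteq> {}"
    using assms(2) by (auto simp: graphical_building_set_def)
  then have finF: "finite F"
    using simple_graph_finite_edges[OF assms(1)] finite_subset by blast
  have E: "finite e" "card e = 2" if "e \<in> E" for e
    using assms(1) that finite_subset by (auto simp: simple_graph_def)
  obtain e where "e \<in> F"
    using F(2) by auto
  then have "{e} \<in> \<W>"
    using E F(1) by (auto simp: \<W>_def)
  moreover have "finite \<W>"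
    using finF by (simp add: \<W>_def)
  moreover note finite_has_maximal2[of \<W> "{e}"]
  ultimately obtain W where "W \<in> \<W>" and max: "\<forall>W'\<in>\<W>. W \<subseteq> W' \<longrightarrow> W = W'"
    by blast
  then have W: "W \<subseteq> F" "W \<noteq> {}" "card (\<Union>W) \<le> card W + 1"
    by (simp_all add: \<W>_def)
  have "W = F"
  proof (rule ccontr)
    assume "W \<noteq> F"
    then obtain e f where ef: "e \<in> W" "f \<in> F - W" "{e, f} \<in> line_graph_edges E"
      using graphical_crossing_edge[OF assms(2), of W] W by blast
    have "f \<in> E"
      using ef(2) F(1) by blast
    note f = E[OF this]
    obtain v where "v \<in> e" "v \<in> f"
      using line_graph_edgeD[OF ef(3)] by blast
    have "f - \<Union>W \<subseteq> f - {v}"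
      using ef(1) \<open>v \<in> e\<close> by blast
    then have "card (f - \<Union>W) \<le> 1"
      using card_mono[of "f - {v}" "f - \<Union>W"] f \<open>v \<in> f\<close> by simp
    moreover have "card (\<Union>W \<union> (f - \<Union>W)) \<le> card (\<Union>W) + card (f - \<Union>W)"
      by (rule card_Un_le)
    moreover have "\<Union>(insert f W) = \<Union>W \<union> (f - \<Union>W)"
      by blast
    moreover have "card (insert f W) = card W + 1"
      using ef(2) W finite_subset[OF _ finF] by simp
    ultimately have "card (\<Union>(insert f W)) \<le> card (insert f W) + 1"
      using W by simp
    then have "insert f W \<in> \<W>"
      using W ef(2) by (auto simp: \<W>_def)
    then show False
      using max ef(2) by blast
  qed
  then show ?thesis
    using W by simp
qed

section \<open>The two generating functions of a forest\<close>

locale finite_forest =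
  fixes V :: "'v set" and E :: "'v set set"
  assumes forest: "forest V E"
begin

abbreviation "BG \<equiv> graphical_building_set V E"
abbreviation "BL \<equiv> graphical_building_set E (line_graph_edges E)"

lemma simple: "simple_graph V E"
  using forest by (simp add: forest_def)

lemma finite_V: "finite V"
  using simple by (simp add: simple_graph_def)

lemma finite_E: "finite E"
  using simple by (rule simple_graph_finite_edges)

lemma edge: "e \<in> E \<Longrightarrow> e \<subseteq> V \<and> e \<noteq> {} \<and> card e = 2"
  using simple by (auto simp: simple_graph_def)

lemma building_set_BG: "building_set V BG"
  using finite_V by (rule building_set_graphical)

lemma building_set_BL: "building_set E BL"
  using finite_E by (rule building_set_graphical)

lemma card_edges_less:
  assumes "F \<subseteq> E" "\<Union>F \<subseteq> W" "W \<subseteq> V" "W \<noteq> {}"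
  shows "card F < card W"
proof (rule acyclic_card_edges_less)
  show "simple_graph W F"
    using assms edge finite_subset[OF _ finite_V] by (auto simp: simple_graph_def)
  show "\<nexists>c. is_cycle F c"
    using forest assms(1) unfolding forest_def is_cycle_def by (meson subsetD)
qed fact

lemma card_edges_le:
  assumes "F \<subseteq> E" "\<Union>F \<subseteq> W" "W \<subseteq> V"
  shows "card F \<le> card W"
proof (cases "W = {}")
  case True
  then have "F = {}"
    using assms(1,2) edge by blast
  then show ?thesis
    by simp
qed (use card_edges_less[OF assms] in simp)

lemma induced_edges_subset: "induced_edges E U \<subseteq> E" "\<Union>(induced_edges E U) \<subseteq> U"
  by (auto simp: induced_edges_def)

lemma finite_induced_edges: "finite (induced_edges E U)"
  using finite_E induced_edges_subset(1) finite_subset by blast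

lemma Union_edges_subset: "F \<subseteq> E \<Longrightarrow> \<Union>F \<subseteq> V"
  using edge by blast

lemma card_edges_le_Union: "F \<subseteq> E \<Longrightarrow> card F \<le> card (\<Union>F)"
  by (rule card_edges_le[OF _ subset_refl Union_edges_subset])

lemma card_induced_edges_le: "U \<subseteq> V \<Longrightarrow> card (induced_edges E U) \<le> card U"
  by (rule card_edges_le[OF induced_edges_subset])

lemma card_induced_edges_less: "U \<subseteq> V \<Longrightarrow> U \<noteq> {} \<Longrightarrow> card (induced_edges E U) < card U"
  by (rule card_edges_less[OF induced_edges_subset])

lemma separated_BL_iff:
  assumes "F \<subseteq> E" "F' \<subseteq> E"
  shows "separated BL F F' \<longleftrightarrow> \<Union>F \<inter> \<Union>F' = {}"
proof
  assume sep: "separated BL F F'"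
  show "\<Union>F \<inter> \<Union>F' = {}"
  proof (rule ccontr)
    assume "\<Union>F \<inter> \<Union>F' \<noteq> {}"
    then obtain v e f where *: "e \<in> F" "f \<in> F'" "v \<in> e" "v \<in> f"
      by blast
    have dis: "F \<inter> F' = {}"
      using sep by (simp add: separated_def)
    then have "e \<noteq> f"
      using * by blast
    then have "{e, f} \<in> line_graph_edges E"
      using * assms unfolding line_graph_edges_def by blast
    then have "{e, f} \<in> BL"
      using * assms by (intro edge_in_graphical_building_set) auto
    then have "{e, f} \<subseteq> F \<or> {e, f} \<subseteq> F'"
      using sep * unfolding separated_def by auto
    then show False
      using * dis by blast
  qed
next
  assume dis: "\<Union>F \<inter> \<Union>F' = {}"
  have "F \<inter> F' = {}"
  proof (rule equals0I)
    fix e assume "e \<in> F \<inter> F'"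
    then show False
      using dis edge[of e] assms(1) by blast
  qed
  moreover have "J \<subseteq> F \<or> J \<subseteq> F'" if J: "J \<in> BL" "J \<subseteq> F \<union> F'" for J
  proof (rule ccontr)
    assume *: "\<not> (J \<subseteq> F \<or> J \<subseteq> F')"
    then have "J \<inter> F \<noteq> {}" "J \<inter> F \<noteq> J"
      using J(2) by blast+
    then obtain e f where ef: "e \<in> J \<inter> F" "f \<in> J - J \<inter> F" "{e, f} \<in> line_graph_edges E"
      using graphical_crossing_edge[OF J(1), of "J \<inter> F"] by blast
    then have "f \<in> F'"
      using J(2) by blast
    then show False
      using line_graph_edgeD[OF ef(3)] ef(1) dis by blast
  qed
  ultimately show "separated BL F F'"
    by (simp add: separated_def)
qed

lemma induced_edges_Un:
  assumes "U \<subseteq> V" "W \<subseteq> V" "separated BG U W"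
  shows "induced_edges E (U \<union> W) = induced_edges E U \<union> induced_edges E W"
proof
  show "induced_edges E (U \<union> W) \<subseteq> induced_edges E U \<union> induced_edges E W"
  proof
    fix e assume "e \<in> induced_edges E (U \<union> W)"
    then have e: "e \<in> E" "e \<subseteq> U \<union> W"
      by (auto simp: induced_edges_def)
    then obtain a b where ab: "e = {a, b}"
      using edge card_2_iff by metis
    then have "e \<in> BG"
      using e(1) edge[OF e(1)] by (auto intro: edge_in_graphical_building_set)
    then have "e \<subseteq> U \<or> e \<subseteq> W"
      using assms(3) e(2) unfolding separated_def by blast
    then show "e \<in> induced_edges E U \<union> induced_edges E W"
      using e(1) by (auto simp: induced_edges_def)
  qed
qed (auto simp: induced_edges_def)

lemma line_gf_eq:
  fixes t :: "'r::comm_ring_1"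
  assumes "F \<subseteq> E"
  shows "(1 + t) ^ (card (\<Union>F) - card F) * cover_gf t BL F
       = t ^ (card (\<Union>F) - card F) * subset_gf 1 t BL F"
proof -
  have "finite F"
    using assms finite_E finite_subset by blast
  then show ?thesis
    using assms
  proof (induction rule: finite_psubset_induct)
    case (psubset F)
    consider "F = {}" | "F \<in> BL" | "F \<noteq> {}" "F \<notin> BL"
      by blast
    then show ?case
    proof cases
      case 1
      then show ?thesis
        by (simp add: subset_gf_def)
    next
      case 2
      have "F \<noteq> {}"
        using 2 by (simp add: graphical_building_set_def)
      then have "\<Union>F \<noteq> {}"
        using psubset.prems edge by blast
      then have "card F < card (\<Union>F)"
        using card_edges_less[OF psubset.prems subset_refl Union_edges_subset[OF psubset.prems]]
        by simp
      then have k: "card (\<Union>F) - card F = 1"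
        using card_line_graphical_le[OF simple 2] by simp
      have "subset_gf 1 t BL F = (\<Sum>W\<in>Pow F. cover_gf t BL W)"
        by (simp add: subset_gf_def)
      also have "\<dots> = cover_gf t BL F + (\<Sum>W\<in>Pow F - {F}. cover_gf t BL W)"
        using psubset.hyps by (intro sum.remove) auto
      finally have "t * subset_gf 1 t BL F = t * cover_gf t BL F + cover_gf t BL F"
        by (simp add: cover_gf_connected[OF building_set_BL 2, of t] distrib_left)
      then show ?thesis
        unfolding k by (simp add: distrib_right)
    next
      case 3
      obtain F1 F2 where F: "F = F1 \<union> F2" "F1 \<noteq> {}" "F2 \<noteq> {}" and sep: "separated BL F1 F2"
        using obtain_separated[OF building_set_BL psubset.prems 3] .
      have sub: "F1 \<subseteq> E" "F2 \<subseteq> E" and fin: "finite F1" "finite F2"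
        using F(1) psubset.prems psubset.hyps by auto
      have dis: "F1 \<inter> F2 = {}" "\<Union>F1 \<inter> \<Union>F2 = {}"
        using sep separated_BL_iff[OF sub] by (auto simp: separated_def)
      then have "F1 \<subset> F" "F2 \<subset> F"
        using F by auto
      note IH = psubset.IH[OF this(1) sub(1)] psubset.IH[OF this(2) sub(2)]
      have "finite (\<Union>F1)" "finite (\<Union>F2)"
        using sub[THEN Union_edges_subset, THEN finite_subset, OF finite_V] by simp_all
      then have "card (\<Union>F) = card (\<Union>F1) + card (\<Union>F2)"
        using dis(2) F(1) by (simp add: card_Un_disjoint)
      moreover have "card F = card F1 + card F2"
        using dis(1) fin F(1) by (simp add: card_Un_disjoint)
      moreover have "card F1 \<le> card (\<Union>F1)" "card F2 \<le> card (\<Union>F2)"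
        using sub by (simp_all add: card_edges_le_Union)
      ultimately have k: "card (\<Union>F) - card F
          = (card (\<Union>F1) - card F1) + (card (\<Union>F2) - card F2)"
        by simp
      show ?thesis
        unfolding k
        unfolding F(1) cover_gf_Un[OF building_set_BL fin sep]
          subset_gf_Un[OF building_set_BL fin sep] power_add
        using arg_cong2[where f = "(*)", OF IH] by (simp only: mult_ac)
    qed
  qed
qed

text \<open>The sum over \<open>W\<close> is a sum over \<open>F\<close> and over \<open>W \<supseteq> \<Union>F\<close> after expanding \<open>subset_gf (1 + t)\<close>.
  The vertices outside \<open>\<Union>F\<close> contribute \<open>1 + t\<close> each.\<close>

lemma sum_induced_subset_gf:
  fixes t :: "'r::comm_ring_1"
  assumes U: "U \<in> BG"
  shows "(\<Sum>W\<in>Pow U. t ^ (card W - card (induced_edges E W))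
            * subset_gf (1 + t) t BL (induced_edges E W))
       = (1 + t) * subset_gf (1 + t) t BL (induced_edges E U)"
proof -
  let ?H = "induced_edges E" and ?y = "subset_gf 1 t BL"
  have UV: "U \<subseteq> V" "U \<noteq> {}"
    using U by (auto simp: graphical_building_set_def)
  have finU: "finite U"
    using UV(1) finite_V finite_subset by blast
  have "card (?H U) < card U"
    using UV by (rule card_induced_edges_less)
  then have cardU: "card U = Suc (card (?H U))"
    using card_graphical_le[OF finite_E finite_V U] by simp
  have "(\<Sum>W\<in>Pow U. t ^ (card W - card (?H W)) * subset_gf (1 + t) t BL (?H W))
      = (\<Sum>W\<in>Pow U. \<Sum>F | F \<in> Pow (?H U) \<and> \<Union>F \<subseteq> W. t ^ (card W - card F) * ?y F)"
  proof (rule sum.cong)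
    fix W assume "W \<in> Pow U"
    have eq: "Pow (?H W) = {F \<in> Pow (?H U). \<Union>F \<subseteq> W}"
      using \<open>W \<in> Pow U\<close> by (auto simp: induced_edges_def)
    have "t ^ (card W - card (?H W)) * subset_gf (1 + t) t BL (?H W)
        = (\<Sum>F\<in>Pow (?H W). t ^ (card W - card (?H W)) * (t ^ card (?H W - F) * ?y F))"
      by (simp add: sum_subset_gf finite_induced_edges flip: sum_distrib_left)
    also have "\<dots> = (\<Sum>F\<in>Pow (?H W). t ^ (card W - card F) * ?y F)"
    proof (rule sum.cong)
      fix F assume F: "F \<in> Pow (?H W)"
      have "card (?H W) \<le> card W"
        using \<open>W \<in> Pow U\<close> UV(1) by (intro card_induced_edges_le) auto
      moreover have "card F \<le> card (?H W)"
        using F finite_induced_edges by (intro card_mono) auto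
      moreover have "card (?H W - F) = card (?H W) - card F"
        using F finite_subset[OF _ finite_induced_edges] by (intro card_Diff_subset) auto
      ultimately have "card W - card F = (card W - card (?H W)) + card (?H W - F)"
        by simp
      then show "t ^ (card W - card (?H W)) * (t ^ card (?H W - F) * ?y F)
          = t ^ (card W - card F) * ?y F"
        by (simp add: power_add mult.assoc)
    qed simp
    finally show "t ^ (card W - card (?H W)) * subset_gf (1 + t) t BL (?H W)
        = (\<Sum>F | F \<in> Pow (?H U) \<and> \<Union>F \<subseteq> W. t ^ (card W - card F) * ?y F)"
      unfolding eq .
  qed simp
  also have "\<dots> = (\<Sum>F\<in>Pow (?H U). \<Sum>W | W \<in> Pow U \<and> \<Union>F \<subseteq> W. t ^ (card W - card F) * ?y F)"
    using finU finite_induced_edges by (intro sum.swap_restrict) auto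
  also have "\<dots> = (\<Sum>F\<in>Pow (?H U). (1 + t) * ((1 + t) ^ card (?H U - F) * cover_gf t BL F))"
  proof (rule sum.cong)
    fix F assume "F \<in> Pow (?H U)"
    then have F: "F \<subseteq> E" "\<Union>F \<subseteq> U" "F \<subseteq> ?H U"
      using induced_edges_subset[of U] by auto
    have finF: "finite (\<Union>F)"
      using F(2) finU by (rule finite_subset)
    have le: "card F \<le> card (\<Union>F)"
      using F(1) by (rule card_edges_le_Union)
    have "card (?H U - F) = card (?H U) - card F" "card F \<le> card (?H U)"
      using F(3) finite_subset[OF F(3) finite_induced_edges]
      by (simp_all add: card_Diff_subset card_mono finite_induced_edges)
    moreover have "card (U - \<Union>F) = card U - card (\<Union>F)" "card (\<Union>F) \<le> card U"
      using F(2) finU finF by (simp_all add: card_Diff_subset card_mono)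
    ultimately have exp: "(card (\<Union>F) - card F) + card (U - \<Union>F) = Suc (card (?H U - F))"
      using le cardU by simp
    have "(\<Sum>W | W \<in> Pow U \<and> \<Union>F \<subseteq> W. t ^ (card W - card F) * ?y F)
        = (\<Sum>W | \<Union>F \<subseteq> W \<and> W \<subseteq> U. t ^ (card W - card F) * ?y F)"
      by (intro sum.cong) auto
    also have "\<dots> = (\<Sum>Q\<in>Pow (U - \<Union>F). t ^ (card (\<Union>F \<union> Q) - card F) * ?y F)"
      using F(2) by (rule sum_between)
    also have "\<dots> = (\<Sum>Q\<in>Pow (U - \<Union>F). (t ^ card Q * 1 ^ card (U - \<Union>F - Q))
        * (t ^ (card (\<Union>F) - card F) * ?y F))"
    proof (rule sum.cong)
      fix Q assume "Q \<in> Pow (U - \<Union>F)"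
      then have "finite Q" "\<Union>F \<inter> Q = {}"
        using finite_subset[of Q U] finU by auto
      then have "card (\<Union>F \<union> Q) - card F = card Q + (card (\<Union>F) - card F)"
        using le finF by (simp add: card_Un_disjoint)
      then show "t ^ (card (\<Union>F \<union> Q) - card F) * ?y F
          = (t ^ card Q * 1 ^ card (U - \<Union>F - Q)) * (t ^ (card (\<Union>F) - card F) * ?y F)"
        by (simp add: power_add mult.assoc)
    qed simp
    also have "\<dots> = (t + 1) ^ card (U - \<Union>F) * (t ^ (card (\<Union>F) - card F) * ?y F)"
      using finU by (simp only: sum_Pow_binomial finite_Diff flip: sum_distrib_right)
    also have "\<dots> = (1 + t) ^ card (U - \<Union>F)
        * ((1 + t) ^ (card (\<Union>F) - card F) * cover_gf t BL F)"
      using line_gf_eq[OF F(1), of t] by (simp add: add.commute)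
    also have "\<dots> = (1 + t) ^ ((card (\<Union>F) - card F) + card (U - \<Union>F)) * cover_gf t BL F"
      by (simp add: power_add mult_ac)
    finally show "(\<Sum>W | W \<in> Pow U \<and> \<Union>F \<subseteq> W. t ^ (card W - card F) * ?y F)
        = (1 + t) * ((1 + t) ^ card (?H U - F) * cover_gf t BL F)"
      unfolding exp by (simp add: mult.assoc)
  qed simp
  finally show ?thesis
    by (simp add: subset_gf_def sum_distrib_left)
qed

lemma vertex_gf_eq:
  fixes t :: "'r::comm_ring_1"
  assumes "U \<subseteq> V"
  shows "cover_gf t BG U = t ^ (card U - card (induced_edges E U))
    * subset_gf (1 + t) t BL (induced_edges E U)"
proof -
  let ?H = "induced_edges E"
  let ?g = "\<lambda>W. t ^ (card W - card (?H W)) * subset_gf (1 + t) t BL (?H W)"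
  have "finite U"
    using assms finite_V finite_subset by blast
  then show ?thesis
    using assms
  proof (induction rule: finite_psubset_induct)
    case (psubset U)
    consider "U = {}" | "U \<in> BG" | "U \<noteq> {}" "U \<notin> BG"
      by blast
    then show ?case
    proof cases
      case 1
      have "?H {} = {}"
        using edge by (auto simp: induced_edges_def)
      then show ?thesis
        using 1 by (simp add: subset_gf_def cover_gf_empty[OF building_set_BG]
            cover_gf_empty[OF building_set_BL])
    next
      case 2
      then have "U \<noteq> {}"
        by (simp add: graphical_building_set_def)
      then have "card (?H U) < card U"
        using psubset.prems by (intro card_induced_edges_less)
      then have k: "card U - card (?H U) = 1"
        using card_graphical_le[OF finite_E finite_V 2] by simp
      have "(\<Sum>W\<in>Pow U. ?g W) = ?g U + (\<Sum>W\<in>Pow U - {U}. ?g W)"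
        using psubset.hyps by (intro sum.remove) auto
      then have "(\<Sum>W\<in>Pow U - {U}. ?g W) = subset_gf (1 + t) t BL (?H U)"
        unfolding sum_induced_subset_gf[OF 2] k by (simp add: distrib_right)
      moreover have "(\<Sum>W\<in>Pow U - {U}. cover_gf t BG W) = (\<Sum>W\<in>Pow U - {U}. ?g W)"
        using psubset.IH psubset.prems by (intro sum.cong) auto
      ultimately show ?thesis
        unfolding k by (simp add: cover_gf_connected[OF building_set_BG 2, of t])
    next
      case 3
      obtain U1 U2 where U: "U = U1 \<union> U2" "U1 \<noteq> {}" "U2 \<noteq> {}" and sep: "separated BG U1 U2"
        using obtain_separated[OF building_set_BG psubset.prems 3] .
      have sub: "U1 \<subseteq> V" "U2 \<subseteq> V" and fin: "finite U1" "finite U2"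
        using U(1) psubset.prems psubset.hyps by auto
      have dis: "U1 \<inter> U2 = {}"
        using sep by (simp add: separated_def)
      then have "U1 \<subset> U" "U2 \<subset> U"
        using U by auto
      note IH = psubset.IH[OF this(1) sub(1)] psubset.IH[OF this(2) sub(2)]
      have H: "?H U = ?H U1 \<union> ?H U2"
        unfolding U(1) using sub sep by (rule induced_edges_Un)
      have "\<Union>(?H U1) \<inter> \<Union>(?H U2) = {}"
        using dis induced_edges_subset(2)[of U1] induced_edges_subset(2)[of U2] by blast
      then have sepH: "separated BL (?H U1) (?H U2)"
        by (simp add: separated_BL_iff induced_edges_subset(1))
      then have "?H U1 \<inter> ?H U2 = {}"
        by (simp add: separated_def)
      then have "card (?H U) = card (?H U1) + card (?H U2)"
        unfolding H by (simp add: card_Un_disjoint finite_induced_edges)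
      moreover have "card U = card U1 + card U2"
        using dis fin U(1) by (simp add: card_Un_disjoint)
      moreover have "card (?H U1) \<le> card U1" "card (?H U2) \<le> card U2"
        using sub by (simp_all add: card_induced_edges_le)
      ultimately have k: "card U - card (?H U)
          = (card U1 - card (?H U1)) + (card U2 - card (?H U2))"
        by simp
      show ?thesis
        unfolding k
        unfolding H subset_gf_Un[OF building_set_BL finite_induced_edges finite_induced_edges sepH]
        unfolding U(1) cover_gf_Un[OF building_set_BG fin sep]
        by (simp only: IH power_add mult_ac)
    qed
  qed
qed

end

section \<open>Nested collections and face numbers\<close>

definition card_poly :: "'c set set \<Rightarrow> int poly" where
  "card_poly C = (\<Sum>N\<in>C. monom 1 1 ^ card N)"

lemma coeff_card_poly:
  assumes "finite C"
  shows "coeff (card_poly C) k = int (card {N \<in> C. card N = k})"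
proof -
  have "coeff (card_poly C) k = (\<Sum>N\<in>C. if card N = k then 1 else 0)"
    by (simp add: card_poly_def coeff_sum monom_power)
  also have "\<dots> = (\<Sum>N\<in>{N \<in> C. card N = k}. 1)"
    using assms by (intro sum.inter_filter[symmetric])
  finally show ?thesis
    by simp
qed

lemma coeff_0_card_poly:
  assumes "finite C" "{} \<in> C" "\<And>N. N \<in> C \<Longrightarrow> finite N"
  shows "coeff (card_poly C) 0 = 1"
proof -
  have "{N \<in> C. card N = 0} = {{}}"
    using assms(2,3) by auto
  then show ?thesis
    using assms(1) by (simp add: coeff_card_poly)
qed

lemma maximal_members_subset: "maximal_members B \<subseteq> B"
  by (auto simp: maximal_members_def)

lemma subset_maximal_member:
  assumes "building_set X B" "J \<in> B"
  obtains I where "I \<in> maximal_members B" "J \<subseteq> I"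
proof -
  obtain I where "I \<in> B" "J \<subseteq> I" "\<forall>K\<in>B. I \<subseteq> K \<longrightarrow> I = K"
    using finite_has_maximal2[OF building_set_finite_members[OF assms(1)] assms(2)] by blast
  then have "I \<in> maximal_members B"
    by (auto simp: maximal_members_def)
  then show ?thesis
    using that \<open>J \<subseteq> I\<close> by blast
qed

lemma maximal_member_absorbs:
  assumes "building_set X B" "I \<in> maximal_members B" "J \<in> B" "J \<inter> I \<noteq> {}"
  shows "J \<subseteq> I"
proof -
  have "I \<in> B" and max: "\<And>K. K \<in> B \<Longrightarrow> I \<subseteq> K \<Longrightarrow> K = I"
    using assms(2) by (auto simp: maximal_members_def)
  then have "I \<union> J \<in> B"
    using building_set_Un[OF assms(1)] assms(3,4) by (metis Int_commute)
  then show ?thesis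
    using max[of "I \<union> J"] by auto
qed

lemma maximal_members_subset_cover:
  assumes "building_set X B" "N \<in> nested_covers B X"
  shows "maximal_members B \<subseteq> N"
proof
  fix I assume I: "I \<in> maximal_members B"
  then have "I \<in> B"
    using maximal_members_subset by blast
  have N: "N \<subseteq> B" "nested_in B N" "\<Union>N = X"
    using assms(2) by (auto simp: nested_covers_def)
  have "I \<subseteq> \<Union>{J \<in> N. J \<subseteq> I}"
  proof
    fix i assume i: "i \<in> I"
    then have "i \<in> \<Union>N"
      using N(3) building_set_subset[OF assms(1) \<open>I \<in> B\<close>] by blast
    then obtain J where "J \<in> N" "i \<in> J"
      by blast
    then have "J \<subseteq> I"
      using maximal_member_absorbs[OF assms(1) I, of J] N(1) i by blast
    then show "i \<in> \<Union>{J \<in> N. J \<subseteq> I}"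
      using \<open>J \<in> N\<close> \<open>i \<in> J\<close> by blast
  qed
  then have "\<Union>{J \<in> N. J \<subseteq> I} = I"
    by blast
  moreover have "{J \<in> N. J \<subseteq> I} \<subseteq> N"
    by blast
  then have "nested_in B {J \<in> N. J \<subseteq> I}" "{J \<in> N. J \<subseteq> I} \<subseteq> B"
    using nested_in_mono[OF N(2)] N(1) by auto
  ultimately have "{J \<in> N. J \<subseteq> I} \<in> nested_covers B I"
    by (simp add: nested_covers_def)
  then show "I \<in> N"
    using mem_nested_cover[OF assms(1) \<open>I \<in> B\<close>] by blast
qed

lemma Un_maximal_members_cover:
  assumes "building_set X B" "N \<in> nested_collections B"
  shows "N \<union> maximal_members B \<in> nested_covers B X"
proof -
  let ?M = "maximal_members B"
  have N: "N \<subseteq> B" "nested_in B N"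
    using assms(2) by (auto simp: nested_collections_def)
  have sub: "N \<union> ?M \<subseteq> B"
    using N(1) maximal_members_subset by blast
  have abs: "J \<subseteq> I \<or> J \<inter> I = {}" if "I \<in> ?M" "J \<in> B" for I J
    using maximal_member_absorbs[OF assms(1) that] by blast
  have "\<Union>S \<notin> B" if S: "S \<subseteq> N \<union> ?M" "finite S" "card S \<ge> 2" "disjoint S" for S
  proof
    assume "\<Union>S \<in> B"
    show False
    proof (cases "S \<subseteq> N")
      case True
      then show False
        using N(2) S(2-4) \<open>\<Union>S \<in> B\<close> by (auto simp: nested_in_def)
    next
      case False
      then obtain I where I: "I \<in> S" "I \<in> ?M"
        using S(1) by blast
      then have "\<Union>S = I"
        using \<open>\<Union>S \<in> B\<close> Union_upper[OF I(1)] unfolding maximal_members_def by blast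
      have "\<not> S \<subseteq> {I}"
        using S(3) card_mono[of "{I}" S] by auto
      then obtain J where J: "J \<in> S" "J \<noteq> I"
        by blast
      then have "J \<inter> I = {}"
        using S(4) I(1) by (auto simp: disjoint_def)
      moreover have "J \<subseteq> I"
        using J(1) \<open>\<Union>S = I\<close> by blast
      moreover have "J \<noteq> {}"
        using J(1) S(1) sub building_set_nonempty[OF assms(1)] by blast
      ultimately show False
        by blast
    qed
  qed
  moreover have "I \<subseteq> J \<or> J \<subseteq> I \<or> I \<inter> J = {}" if IJ: "I \<in> N \<union> ?M" "J \<in> N \<union> ?M" for I J
  proof (cases "I \<in> ?M \<or> J \<in> ?M")
    case True
    moreover have "I \<in> B" "J \<in> B"
      using IJ sub by auto
    ultimately show ?thesis
      using abs[of I J] abs[of J I] by (auto simp: Int_commute)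
  next
    case False
    then show ?thesis
      using IJ N(2) by (auto simp: nested_in_def)
  qed
  ultimately have "nested_in B (N \<union> ?M)"
    unfolding nested_in_def by (intro conjI ballI allI impI) auto
  moreover have "\<Union>(N \<union> ?M) = X"
  proof
    show "\<Union>(N \<union> ?M) \<subseteq> X"
      using sub building_set_subset[OF assms(1)] by blast
    show "X \<subseteq> \<Union>(N \<union> ?M)"
    proof
      fix i assume "i \<in> X"
      then obtain I where "I \<in> ?M" "{i} \<subseteq> I"
        using subset_maximal_member[OF assms(1)] building_set_singleton[OF assms(1)] by metis
      then show "i \<in> \<Union>(N \<union> ?M)"
        by blast
    qed
  qed
  ultimately show ?thesis
    using sub by (simp add: nested_covers_def)
qed

lemma finite_nested_collections:
  assumes "building_set X B"
  shows "finite (nested_collections B)"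
proof -
  have "nested_collections B \<subseteq> Pow B"
    by (auto simp: nested_collections_def)
  then show ?thesis
    using building_set_finite_members[OF assms] by (metis finite_Pow_iff finite_subset)
qed

lemma finite_nested_collection:
  assumes "building_set X B" "N \<in> nested_collections B"
  shows "finite N"
proof -
  have "N \<subseteq> B"
    using assms(2) by (auto simp: nested_collections_def)
  then show ?thesis
    using building_set_finite_members[OF assms(1)] by (rule finite_subset)
qed

lemma cover_gf_eq_card_poly:
  assumes "building_set X B"
  shows "cover_gf (monom 1 1) B X
    = monom 1 (card (maximal_members B)) * card_poly (nested_collections B)"
proof -
  let ?M = "maximal_members B"
  have fin: "finite ?M"
    using building_set_finite_members[OF assms] maximal_members_subset by (rule rev_finite_subset)
  have "cover_gf (monom 1 1) B X
      = (\<Sum>N\<in>nested_collections B. monom 1 (card ?M) * monom 1 1 ^ card N :: int poly)"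
    unfolding cover_gf_def
  proof (rule sum.reindex_bij_witness[where i = "\<lambda>N. N \<union> ?M" and j = "\<lambda>N. N - ?M"])
    fix N assume N: "N \<in> nested_covers B X"
    then have M: "?M \<subseteq> N"
      using maximal_members_subset_cover[OF assms] by blast
    then show "N - ?M \<union> ?M = N"
      by blast
    have "nested_in B N"
      using N by (simp add: nested_covers_def)
    then have "nested_in B (N - ?M)"
      by (rule nested_in_mono) blast
    then show "N - ?M \<in> nested_collections B"
      using N by (auto simp: nested_collections_def nested_covers_def)
    have "finite N"
      using building_set_finite[OF assms] N by (rule finite_nested_cover)
    then have "card N = card ?M + card (N - ?M)"
      using M by (simp add: card_Diff_subset card_mono finite_subset)
    then show "monom 1 (card ?M) * monom 1 1 ^ card (N - ?M) = monom 1 1 ^ card N"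
      by (simp add: monom_power mult_monom)
  next
    fix N assume N: "N \<in> nested_collections B"
    then show "N \<union> ?M - ?M = N"
      by (auto simp: nested_collections_def)
    show "N \<union> ?M \<in> nested_covers B X"
      using assms N by (rule Un_maximal_members_cover)
  qed
  then show ?thesis
    by (simp add: card_poly_def sum_distrib_left)
qed

lemma extended_nested_collections_subset_Pow:
  "extended_nested_collections X B \<subseteq> Pow (Inl ` B \<union> Inr ` X)"
  by (auto simp: extended_nested_collections_def)

lemma finite_extended_ground: "building_set X B \<Longrightarrow> finite (Inl ` B \<union> Inr ` X)"
  by (simp add: building_set_finite_members building_set_finite)

lemma finite_extended_nested_collections:
  assumes "building_set X B"
  shows "finite (extended_nested_collections X B)"
  using finite_extended_ground[OF assms] extended_nested_collections_subset_Pow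
  by (metis finite_Pow_iff finite_subset)

lemma finite_extended_nested_collection:
  assumes "building_set X B" "M \<in> extended_nested_collections X B"
  shows "finite M"
proof -
  have "M \<subseteq> Inl ` B \<union> Inr ` X"
    using assms(2) extended_nested_collections_subset_Pow by blast
  then show ?thesis
    using finite_extended_ground[OF assms(1)] by (rule finite_subset)
qed

lemma card_poly_extended_nested_collections:
  assumes "building_set X B"
  shows "card_poly (extended_nested_collections X B) = subset_gf (1 + monom 1 1) (monom 1 1) B X"
proof -
  let ?t = "monom 1 1 :: int poly"
  have finX: "finite X" and finB: "finite B"
    using building_set_finite[OF assms] building_set_finite_members[OF assms] .
  have fin: "finite (X - W)" for W
    using finX by simp
  define D where "D = (SIGMA W:Pow X. nested_covers B W \<times> Pow (X - W))"
  have vim: "Inl -` (Inl ` N \<union> Inr ` S) = N" "Inr -` (Inl ` N \<union> Inr ` S) = S"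
    for N :: "'a set set" and S :: "'a set"
    by auto
  have "card_poly (extended_nested_collections X B)
      = (\<Sum>(W, N, S)\<in>D. ?t ^ card N * (?t ^ card S * 1 ^ card (X - W - S)))"
    unfolding card_poly_def
  proof (rule sum.reindex_bij_witness[where i = "\<lambda>(W, N, S). Inl ` N \<union> Inr ` S"
        and j = "\<lambda>M. (\<Union>(Inl -` M), Inl -` M, Inr -` M)"])
    fix M assume "M \<in> extended_nested_collections X B"
    then obtain N S where M: "M = Inl ` N \<union> Inr ` S"
      and NS: "N \<subseteq> B" "S \<subseteq> X" "nested_in B N" "\<forall>i\<in>S. \<forall>I\<in>N. i \<notin> I"
      by (auto simp: extended_nested_collections_def)
    show "(case (\<Union>(Inl -` M), Inl -` M, Inr -` M) of (W, N, S) \<Rightarrow> Inl ` N \<union> Inr ` S) = M"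
      by (simp only: M vim prod.case)
    have "\<Union>N \<subseteq> X"
      using NS(1) building_set_subset[OF assms] by blast
    moreover have "N \<in> nested_covers B (\<Union>N)"
      using NS(1,3) by (simp add: nested_covers_def)
    moreover have "S \<subseteq> X - \<Union>N"
      using NS(2,4) by blast
    ultimately show "(\<Union>(Inl -` M), Inl -` M, Inr -` M) \<in> D"
      unfolding M vim D_def by simp
    have "finite N" "finite S"
      using NS(1,2) finX finB by (auto intro: finite_subset)
    then have "card M = card N + card S"
      unfolding M by (subst card_Un_disjoint) (auto simp: card_image)
    then show "(case (\<Union>(Inl -` M), Inl -` M, Inr -` M) of
          (W, N, S) \<Rightarrow> ?t ^ card N * (?t ^ card S * 1 ^ card (X - W - S))) = ?t ^ card M"
      unfolding M vim by (simp add: power_add)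
  next
    fix d assume "d \<in> D"
    then obtain W N S where d: "d = (W, N, S)" and NS: "N \<in> nested_covers B W" "S \<subseteq> X - W"
      by (auto simp: D_def)
    then have "N \<subseteq> B" "nested_in B N" "\<Union>N = W"
      by (simp_all add: nested_covers_def)
    then show "(\<Union>(Inl -` (case d of (W, N, S) \<Rightarrow> Inl ` N \<union> Inr ` S)),
        Inl -` (case d of (W, N, S) \<Rightarrow> Inl ` N \<union> Inr ` S),
        Inr -` (case d of (W, N, S) \<Rightarrow> Inl ` N \<union> Inr ` S)) = d"
      unfolding d prod.case vim by simp
    have "S \<subseteq> X" "\<forall>i\<in>S. \<forall>I\<in>N. i \<notin> I"
      using NS(2) \<open>\<Union>N = W\<close> by auto
    then show "(case d of (W, N, S) \<Rightarrow> Inl ` N \<union> Inr ` S) \<in> extended_nested_collections X B"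
      using \<open>N \<subseteq> B\<close> \<open>nested_in B N\<close> unfolding d extended_nested_collections_def by auto
  qed
  also have "\<dots> = (\<Sum>W\<in>Pow X. \<Sum>(N, S)\<in>nested_covers B W \<times> Pow (X - W).
      ?t ^ card N * (?t ^ card S * 1 ^ card (X - W - S)))"
    unfolding D_def using finX finite_nested_covers[OF finite_subset[OF _ finX]]
    by (subst sum.Sigma) auto
  also have "\<dots> = (\<Sum>W\<in>Pow X. cover_gf ?t B W * (?t + 1) ^ card (X - W))"
    unfolding cover_gf_def sum_Pow_binomial[OF fin, symmetric]
    by (simp only: sum_product sum.cartesian_product)
  finally show ?thesis
    by (simp add: subset_gf_def mult.commute add.commute)
qed

lemma empty_in_nested_collections:
  "building_set X B \<Longrightarrow> {} \<in> nested_collections B"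
  by (auto simp: nested_collections_def nested_in_def)

lemma empty_in_extended_nested_collections:
  "building_set X B \<Longrightarrow> {} \<in> extended_nested_collections X B"
  by (auto simp: extended_nested_collections_def nested_in_def)

lemma nested_collections_downward:
  assumes "N \<in> nested_collections B" "M \<subseteq> N"
  shows "M \<in> nested_collections B"
  using assms nested_in_mono[of B N M] by (auto simp: nested_collections_def)

lemma extended_nested_collections_downward:
  assumes "M \<in> extended_nested_collections X B" "M' \<subseteq> M"
  shows "M' \<in> extended_nested_collections X B"
proof -
  obtain N S where M: "M = Inl ` N \<union> Inr ` S"
    and NS: "N \<subseteq> B" "S \<subseteq> X" "nested_in B N" "\<forall>i\<in>S. \<forall>I\<in>N. i \<notin> I"
    using assms(1) by (auto simp: extended_nested_collections_def)
  obtain N' S' where M': "N' \<subseteq> N" "S' \<subseteq> S" "M' = Inl ` N' \<union> Inr ` S'"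
    using assms(2) unfolding M by (metis subset_UnE subset_imageE)
  have "N' \<subseteq> B" "S' \<subseteq> X" "\<forall>i\<in>S'. \<forall>I\<in>N'. i \<notin> I"
    using NS M'(1,2) by blast+
  moreover have "nested_in B N'"
    using nested_in_mono NS(3) M'(1) .
  ultimately show ?thesis
    unfolding extended_nested_collections_def M'(3) by blast
qed

text \<open>Along a chain of faces in which each one is a facet of the next, the dual set loses one
  element at a time, because the dual complex is closed under subsets.\<close>

lemma card_dual_diff_eq_aff_dim_diff:
  fixes P :: "'a::euclidean_space set"
  assumes P: "polytope P"
    and bij: "bij_betw \<phi> {F. F face_of P \<and> F \<noteq> {}} C"
    and ord: "\<And>F G. F face_of P \<Longrightarrow> F \<noteq> {} \<Longrightarrow> G face_of P \<Longrightarrow> G \<noteq> {} \<Longrightarrow>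
        F \<subseteq> G \<longleftrightarrow> \<phi> G \<subseteq> \<phi> F"
    and down: "\<And>M N. N \<in> C \<Longrightarrow> M \<subseteq> N \<Longrightarrow> M \<in> C"
    and fin: "\<And>N. N \<in> C \<Longrightarrow> finite N"
    and "G face_of P" "F face_of P" "F \<noteq> {}" "F \<subseteq> G"
  shows "int (card (\<phi> F)) - int (card (\<phi> G)) = aff_dim G - aff_dim F"
  using assms(6-9)
proof (induction "nat (aff_dim G + 1)" arbitrary: G rule: less_induct)
  case less
  note F = less.prems(2,3)
  have G: "G face_of P" "G \<noteq> {}"
    using less.prems by auto
  show ?case
  proof (cases "F = G")
    case False
    have \<phi>: "\<phi> K \<in> C" if "K face_of P" "K \<noteq> {}" for K
      using bij_betwE[OF bij] that by blast
    have polyG: "polytope G"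
      using P G(1) by (rule face_of_polytope_polytope)
    have "F face_of G"
      using face_of_face[OF G(1)] F(1) less.prems(4) by blast
    then obtain K where K: "K facet_of G" "F \<subseteq> K"
      using face_of_polyhedron_subset_facet[OF polytope_imp_polyhedron[OF polyG]] F(2) False
      by blast
    have KG: "K face_of G" "K \<noteq> {}" "aff_dim K = aff_dim G - 1" "K \<subseteq> G"
      using K(1) face_of_imp_subset by (auto simp: facet_of_def)
    have KP: "K face_of P"
      using KG(1) G(1) by (rule face_of_trans)
    have "aff_dim K \<ge> 0"
      using KG(2) aff_dim_geq[of K] aff_dim_empty[of K] by linarith
    then have IH: "int (card (\<phi> F)) - int (card (\<phi> K)) = aff_dim K - aff_dim F"
      using less.hyps[of K] KP F K(2) KG(3) by simp
    have "\<phi> G \<subseteq> \<phi> K"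
      using ord[OF KP KG(2) G] KG(4) by blast
    moreover have "\<not> G \<subseteq> K"
      using KG(3,4) by auto
    then have "\<not> \<phi> K \<subseteq> \<phi> G"
      using ord[OF G KP KG(2)] by blast
    ultimately obtain x where x: "x \<in> \<phi> K" "x \<notin> \<phi> G"
      by blast
    have "insert x (\<phi> G) \<subseteq> \<phi> K"
      using x \<open>\<phi> G \<subseteq> \<phi> K\<close> by blast
    then have "insert x (\<phi> G) \<in> C"
      using down \<phi>[OF KP KG(2)] by blast
    then have "insert x (\<phi> G) \<in> \<phi> ` {F. F face_of P \<and> F \<noteq> {}}"
      using bij_betw_imp_surj_on[OF bij] by simp
    then obtain L where L: "L face_of P" "L \<noteq> {}" "\<phi> L = insert x (\<phi> G)"
      by force
    have "K \<subseteq> L" "L \<subseteq> G"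
      using ord[OF KP KG(2) L(1,2)] ord[OF L(1,2) G] L(3) \<open>insert x (\<phi> G) \<subseteq> \<phi> K\<close> by auto
    have "L \<noteq> G"
      using L(3) x(2) by auto
    have "K face_of L" "L face_of G"
      using face_of_face[OF L(1)] face_of_face[OF G(1)] KP L(1) \<open>K \<subseteq> L\<close> \<open>L \<subseteq> G\<close> by auto
    then have "aff_dim L < aff_dim G"
      using face_of_aff_dim_lt[OF face_of_imp_convex[OF G(1)]] \<open>L \<noteq> G\<close> by blast
    have "K = L"
    proof (rule ccontr)
      assume "K \<noteq> L"
      then have "aff_dim K < aff_dim L"
        using face_of_aff_dim_lt[OF face_of_imp_convex[OF L(1)]] \<open>K face_of L\<close> by blast
      then show False
        using \<open>aff_dim L < aff_dim G\<close> KG(3) by linarith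
    qed
    then have "card (\<phi> K) = card (\<phi> G) + 1"
      using L(3) x(2) fin[OF \<phi>[OF G]] by simp
    then show ?thesis
      using IH KG(3) by simp
  qed simp
qed

lemma f_polynomial_dual:
  fixes P :: "'a::euclidean_space set"
  assumes P: "polytope P" "aff_dim P = int d" and dual: "face_poset_dual_to P C"
    and down: "\<And>M N. N \<in> C \<Longrightarrow> M \<subseteq> N \<Longrightarrow> M \<in> C"
    and fin: "\<And>N. N \<in> C \<Longrightarrow> finite N"
  shows "f_polynomial P = (\<Sum>i\<le>d. monom (int (card {N \<in> C. card N = d - i})) i)"
proof -
  let ?\<F> = "{F. F face_of P \<and> F \<noteq> {}}"
  obtain \<phi> where bij: "bij_betw \<phi> ?\<F> C"
    and ord: "\<And>F G. F face_of P \<Longrightarrow> F \<noteq> {} \<Longrightarrow> G face_of P \<Longrightarrow> G \<noteq> {} \<Longrightarrow>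
        F \<subseteq> G \<longleftrightarrow> \<phi> G \<subseteq> \<phi> F"
    using dual unfolding face_poset_dual_to_def by metis
  have top: "P face_of P" "P \<noteq> {}"
    using polytope_imp_convex[OF P(1)] P(2) by (auto simp: face_of_refl)
  have "\<phi> P \<in> C"
    using bij_betwE[OF bij] top by blast
  then have "{} \<in> C"
    using down by blast
  then have "{} \<in> \<phi> ` ?\<F>"
    using bij_betw_imp_surj_on[OF bij] by simp
  then obtain F where F: "F face_of P" "F \<noteq> {}" "\<phi> F = {}"
    by auto
  then have "P = F"
    using ord[OF top F(1,2)] face_of_imp_subset[OF F(1)] by blast
  then have "\<phi> P = {}"
    using F(3) by simp
  then have dim: "int (card (\<phi> F)) = int d - aff_dim F" if "F face_of P" "F \<noteq> {}" for F
    using card_dual_diff_eq_aff_dim_diff[OF P(1) bij ord down fin top(1) that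
        face_of_imp_subset[OF that(1)]] P(2) by simp
  have "face_number P i = card {N \<in> C. card N = d - i}" if "i \<le> d" for i
  proof -
    have bij': "bij_betw \<phi> {F \<in> ?\<F>. card (\<phi> F) = d - i} {N \<in> C. card N = d - i}"
      using bij unfolding bij_betw_def by (auto simp: inj_on_def)
    have eq: "{F. F face_of P \<and> aff_dim F = int i} = {F \<in> ?\<F>. card (\<phi> F) = d - i}"
    proof -
      have "aff_dim F = int i \<longleftrightarrow> card (\<phi> F) = d - i" if "F face_of P" "F \<noteq> {}" for F
        using dim[OF that] \<open>i \<le> d\<close> by linarith
      moreover have "F \<noteq> {}" if "aff_dim F = int i" for F :: "'a set"
        using that by auto
      ultimately show ?thesis
        by blast
    qed
    show ?thesis
      unfolding face_number_def eq using bij' by (rule bij_betw_same_card)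
  qed
  then show ?thesis
    unfolding f_polynomial_def P(2) by simp
qed

lemma f_polynomial_nestohedron:
  assumes "building_set X B" "is_nestohedron X B P"
  shows "f_polynomial P = nestohedron_f X B"
  unfolding nestohedron_f_def Let_def
proof (rule f_polynomial_dual)
  show "polytope P" "aff_dim P = int (nestohedron_dim X B)"
    "face_poset_dual_to P (nested_collections B)"
    using assms(2) by (auto simp: is_nestohedron_def simple_polytope_def)
qed (use assms(1) nested_collections_downward finite_nested_collection in blast)+

lemma f_polynomial_extended_nestohedron:
  assumes "building_set X B" "is_extended_nestohedron X B P"
  shows "f_polynomial P = extended_nestohedron_f X B"
  unfolding extended_nestohedron_f_def Let_def
proof (rule f_polynomial_dual)
  show "polytope P" "aff_dim P = int (card X)"
    "face_poset_dual_to P (extended_nested_collections X B)"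
    using assms(2) by (auto simp: is_extended_nestohedron_def simple_polytope_def)
qed (use assms(1) extended_nested_collections_downward finite_extended_nested_collection in blast)+

context finite_forest
begin

text \<open>Both counting polynomials have constant term \<open>1\<close>, so comparing the lowest powers of \<open>t\<close> in
  the identity for \<open>U = V\<close> also shows that the forest has \<open>card V - card E\<close> components.\<close>

lemma card_poly_eq:
  "card_poly (nested_collections BG) = card_poly (extended_nested_collections E BL)"
  "nestohedron_dim V BG = card E"
proof -
  let ?m = "card (maximal_members BG)" and ?n = "card V - card E"
  let ?T = "card_poly (nested_collections BG)"
  let ?X = "card_poly (extended_nested_collections E BL)"
  have E: "induced_edges E V = E"
    using edge by (auto simp: induced_edges_def)
  have "monom 1 ?m * ?T = monom 1 ?n * ?X"
    using vertex_gf_eq[of V "monom 1 1 :: int poly"]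
    unfolding E cover_gf_eq_card_poly[OF building_set_BG]
      card_poly_extended_nested_collections[OF building_set_BL]
    by (simp add: monom_power)
  then have coeff_eq: "(if k < ?m then 0 else coeff ?T (k - ?m))
      = (if k < ?n then 0 else coeff ?X (k - ?n))" for k
    by (metis (no_types, lifting) coeff_monom_mult mult_1)
  have T0: "coeff ?T 0 = 1"
    using finite_nested_collections[OF building_set_BG]
      empty_in_nested_collections[OF building_set_BG] finite_nested_collection[OF building_set_BG]
    by (rule coeff_0_card_poly)
  have X0: "coeff ?X 0 = 1"
    using finite_extended_nested_collections[OF building_set_BL]
      empty_in_extended_nested_collections[OF building_set_BL]
      finite_extended_nested_collection[OF building_set_BL]
    by (rule coeff_0_card_poly)
  have "?m = ?n"
    using coeff_eq[of ?m] coeff_eq[of ?n] T0 X0 by (auto split: if_splits)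
  then have "coeff ?T k = coeff ?X k" for k
    using coeff_eq[of "k + ?m"] by simp
  then show "?T = ?X"
    by (rule poly_eqI)
  have "card E \<le> card V"
    using card_induced_edges_le[OF subset_refl] by (simp add: E)
  then show "nestohedron_dim V BG = card E"
    unfolding nestohedron_dim_def \<open>?m = ?n\<close> by simp
qed

lemma nestohedron_f_eq: "nestohedron_f V BG = extended_nestohedron_f E BL"
proof -
  have "int (card {N \<in> nested_collections BG. card N = k})
      = int (card {M \<in> extended_nested_collections E BL. card M = k})" for k
    using card_poly_eq(1)
    by (simp flip: coeff_card_poly[OF finite_nested_collections[OF building_set_BG]]
        coeff_card_poly[OF finite_extended_nested_collections[OF building_set_BL]])
  then show ?thesis
    by (simp add: nestohedron_f_def extended_nestohedron_f_def card_poly_eq(2))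
qed

end

theorem theorem5p14:
  fixes V :: "'v set" and E :: "'v set set"
    and P :: "'a::euclidean_space set" and Q :: "'b::euclidean_space set"
  assumes "forest V E"
  shows "h_of_f (nestohedron_f V (graphical_building_set V E)) =
         h_of_f (extended_nestohedron_f E (graphical_building_set E (line_graph_edges E))) \<and>
    (is_nestohedron V (graphical_building_set V E) P \<and>
     is_extended_nestohedron E (graphical_building_set E (line_graph_edges E)) Q \<longrightarrow>
       h_polynomial P = h_polynomial Q)"
proof -
  interpret finite_forest V E
    using assms by unfold_locales
  show ?thesis
    using f_polynomial_nestohedron[OF building_set_BG, of P]
      f_polynomial_extended_nestohedron[OF building_set_BL, of Q] nestohedron_f_eq
    by (simp add: h_polynomial_def)
qed

end
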